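(* (ZFC) If $\kappa$ is a supercompact cardinal, then the structure $\langle V_{\kappa+1}, \in\rangle$ satisfies Semi-Weak Vopěnka's Principle. That is, there is no sequence $\langle G_\alpha : \alpha < \kappa\rangle$ of graphs, with each $G_\alpha \in V_\kappa$, having both of the following properties: (i) whenever $\alpha \le \alpha' < \kappa$ there is a homomorphism $G_{\alpha'} \to G_\alpha$ (not necessarily unique); and (ii) whenever $\alpha < \alpha' < \kappa$ there is no homomorphism $G_\alpha \to G_{\alpha'}$.
   Context: A graph is a structure $\langle G,E\rangle$ where $G$ is a set and $E$ is an arbitrary binary relation on $G$. A homomorphism from $\langle G,E\rangle$ to $\langle G',E'\rangle$ is a function $h: G\to G'$ such that $\langle v,w\rangle\in E$ implies $\langle h(v),h(w)\rangle\in E'$. Semi-Weak Vopěnka's Principle (SWVP), a statement of second-order set theory, says that no sequence of graphs $\langle G_\alpha:\alpha\in\mathrm{Ord}\rangle$ has both of the following properties: whenever $\alpha\le\alpha'$ there is a homomorphism $G_{\alpha'}\to G_\alpha$ (not necessarily unique), and whenever $\alpha<\alpha'$ there is no homomorphism $G_\alpha\to G_{\alpha'}$. $V_\alpha$ denotes the $\alpha$-th level of the cumulative hierarchy (the set of all sets of rank less than $\alpha$). For $\kappa$ inaccessible, the structure $\langle V_{\kappa+1},\in\rangle$ is regarded as a model of second-order set theory whose sets are the elements of $V_\kappa$ and whose classes are the elements of $V_{\kappa+1}$ (supercompact cardinals are inaccessible). For a cardinal $\kappa$ and a set $X$, $\mathcal{P}_\kappa(X)=\{A\subset X: |A|<\kappa\}$.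 For an uncountable cardinal $\kappa$ and a set $X$, $\kappa$ is $X$-supercompact if there is a normal fine $\kappa$-complete ultrafilter $U$ on $\mathcal{P}_\kappa(X)$, where: fine means that for every $x\in X$ the set $\{A\in\mathcal{P}_\kappa(X): x\in A\}$ is in $U$; $\kappa$-complete means that the intersection of fewer than $\kappa$ many sets in $U$ is in $U$; normal means that every choice function (a function $f$ with $f(A)\in A$ for all $A$ in its domain) defined on a set in $U$ is constant on a set in $U$. An uncountable cardinal $\kappa$ is supercompact if it is $X$-supercompact for every set $X$. *)

theory Defs
  imports Main
begin

text \<open>
  ZFC is rendered as the first-order theory it is: its models consist of an arbitrary type
  \<open>'v\<close> with a binary relation \<open>mem\<close> satisfying the axioms of ZFC, where Separation and
  Replacement range over first-order formulas with parameters only. All set-theoretic notions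
  below quantify over the elements of \<open>'v\<close> only, so each of them is first-order over \<open>mem\<close>.
  Functions, ordered pairs, families of sets, ultrafilters etc. are elements of \<open>'v\<close>.
\<close>

datatype fm = FMem nat nat | FEq nat nat | FNeg fm | FAnd fm fm | FAll nat fm

locale set_lang =
  fixes mem :: "'v \<Rightarrow> 'v \<Rightarrow> bool"  (infix \<open>\<epsilon>\<close> 50)
begin

primrec sat :: "fm \<Rightarrow> (nat \<Rightarrow> 'v) \<Rightarrow> bool" where
  "sat (FMem i j) e \<longleftrightarrow> e i \<epsilon> e j"
| "sat (FEq i j) e \<longleftrightarrow> e i = e j"
| "sat (FNeg p) e \<longleftrightarrow> \<not> sat p e"
| "sat (FAnd p q) e \<longleftrightarrow> sat p e \<and> sat q e"
| "sat (FAll n p) e \<longleftrightarrow> (\<forall>x. sat p (e(n := x)))"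

subsection \<open>Basic notions\<close>

definition is_subset :: "'v \<Rightarrow> 'v \<Rightarrow> bool" where
  "is_subset a b \<longleftrightarrow> (\<forall>x. x \<epsilon> a \<longrightarrow> x \<epsilon> b)"

definition is_void :: "'v \<Rightarrow> bool" where
  "is_void a \<longleftrightarrow> (\<forall>x. \<not> x \<epsilon> a)"

definition is_upair :: "'v \<Rightarrow> 'v \<Rightarrow> 'v \<Rightarrow> bool" where
  "is_upair c x y \<longleftrightarrow> (\<forall>z. z \<epsilon> c \<longleftrightarrow> z = x \<or> z = y)"

definition is_opair :: "'v \<Rightarrow> 'v \<Rightarrow> 'v \<Rightarrow> bool" where
  "is_opair p x y \<longleftrightarrow> (\<exists>a b. is_upair a x x \<and> is_upair b x y \<and> is_upair p a b)"

definition is_succ :: "'v \<Rightarrow> 'v \<Rightarrow> bool" where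
  "is_succ s a \<longleftrightarrow> (\<forall>x. x \<epsilon> s \<longleftrightarrow> x \<epsilon> a \<or> x = a)"

definition is_inter :: "'v \<Rightarrow> 'v \<Rightarrow> 'v \<Rightarrow> bool" where
  "is_inter c a b \<longleftrightarrow> (\<forall>x. x \<epsilon> c \<longleftrightarrow> x \<epsilon> a \<and> x \<epsilon> b)"

definition is_diff :: "'v \<Rightarrow> 'v \<Rightarrow> 'v \<Rightarrow> bool" where
  "is_diff c a b \<longleftrightarrow> (\<forall>x. x \<epsilon> c \<longleftrightarrow> x \<epsilon> a \<and> \<not> x \<epsilon> b)"

definition is_Inter :: "'v \<Rightarrow> 'v \<Rightarrow> bool" where
  "is_Inter c S \<longleftrightarrow> (\<forall>x. x \<epsilon> c \<longleftrightarrow> (\<forall>Y. Y \<epsilon> S \<longrightarrow> x \<epsilon> Y))"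

definition is_inductive_set :: "'v \<Rightarrow> bool" where
  "is_inductive_set I \<longleftrightarrow>
     (\<exists>z. is_void z \<and> z \<epsilon> I) \<and> (\<forall>x. x \<epsilon> I \<longrightarrow> (\<exists>s. is_succ s x \<and> s \<epsilon> I))"

subsection \<open>Relations and functions\<close>

text \<open>\<open>rel r x y\<close>: the ordered pair of \<open>x\<close> and \<open>y\<close> is an element of \<open>r\<close>; for a function
  \<open>f\<close>, \<open>rel f x y\<close> says that \<open>x\<close> is in the domain of \<open>f\<close> and \<open>f(x) = y\<close>.\<close>

definition rel :: "'v \<Rightarrow> 'v \<Rightarrow> 'v \<Rightarrow> bool" where
  "rel r x y \<longleftrightarrow> (\<exists>p. is_opair p x y \<and> p \<epsilon> r)"

definition function_on :: "'v \<Rightarrow> 'v \<Rightarrow> bool" where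
  "function_on f D \<longleftrightarrow>
     (\<forall>p. p \<epsilon> f \<longrightarrow> (\<exists>x y. is_opair p x y)) \<and>
     (\<forall>x y y'. rel f x y \<longrightarrow> rel f x y' \<longrightarrow> y = y') \<and>
     (\<forall>x. x \<epsilon> D \<longleftrightarrow> (\<exists>y. rel f x y))"

definition maps :: "'v \<Rightarrow> 'v \<Rightarrow> 'v \<Rightarrow> bool" where
  "maps f A B \<longleftrightarrow> function_on f A \<and> (\<forall>x y. rel f x y \<longrightarrow> y \<epsilon> B)"

definition is_injection :: "'v \<Rightarrow> 'v \<Rightarrow> 'v \<Rightarrow> bool" where
  "is_injection f A B \<longleftrightarrow>
     maps f A B \<and> (\<forall>x x' y. rel f x y \<longrightarrow> rel f x' y \<longrightarrow> x = x')"

definition is_bijection :: "'v \<Rightarrow> 'v \<Rightarrow> 'v \<Rightarrow> bool" where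
  "is_bijection f A B \<longleftrightarrow>
     is_injection f A B \<and> (\<forall>y. y \<epsilon> B \<longrightarrow> (\<exists>x. rel f x y))"

subsection \<open>Ordinals and cardinals\<close>

text \<open>In the presence of Foundation, a transitive set of transitive sets is well-ordered by
  membership.\<close>

definition is_transitive :: "'v \<Rightarrow> bool" where
  "is_transitive a \<longleftrightarrow> (\<forall>x. x \<epsilon> a \<longrightarrow> is_subset x a)"

definition is_ordinal :: "'v \<Rightarrow> bool" where
  "is_ordinal a \<longleftrightarrow> is_transitive a \<and> (\<forall>x. x \<epsilon> a \<longrightarrow> is_transitive x)"

definition is_omega :: "'v \<Rightarrow> bool" where
  "is_omega w \<longleftrightarrow> (\<forall>x. x \<epsilon> w \<longleftrightarrow> (\<forall>I. is_inductive_set I \<longrightarrow> x \<epsilon> I))"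

definition equipotent :: "'v \<Rightarrow> 'v \<Rightarrow> bool" where
  "equipotent A B \<longleftrightarrow> (\<exists>f. is_bijection f A B)"

definition is_cardinal :: "'v \<Rightarrow> bool" where
  "is_cardinal k \<longleftrightarrow> is_ordinal k \<and> (\<forall>a. a \<epsilon> k \<longrightarrow> \<not> equipotent a k)"

definition is_countable :: "'v \<Rightarrow> bool" where
  "is_countable A \<longleftrightarrow> (\<exists>w f. is_omega w \<and> is_injection f A w)"

text \<open>The cardinality of \<open>A\<close> is less than the cardinal \<open>k\<close>.\<close>

definition card_less :: "'v \<Rightarrow> 'v \<Rightarrow> bool" where
  "card_less A k \<longleftrightarrow> (\<exists>c. is_cardinal c \<and> equipotent A c \<and> c \<epsilon> k)"

subsection \<open>The cumulative hierarchy\<close>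

text \<open>\<open>is_vlevel a S\<close> says \<open>S = V\<^sub>a\<close>, where \<open>f\<close> is the function
  \<open>b \<mapsto> V\<^sub>b = (\<Union>c\<in>b. Pow V\<^sub>c)\<close> on \<open>a + 1\<close>.\<close>

definition is_vlevel :: "'v \<Rightarrow> 'v \<Rightarrow> bool" where
  "is_vlevel a S \<longleftrightarrow> is_ordinal a \<and>
     (\<exists>f d. is_succ d a \<and> function_on f d \<and>
        (\<forall>b Vb. rel f b Vb \<longrightarrow>
           (\<forall>x. x \<epsilon> Vb \<longleftrightarrow> (\<exists>c Vc. c \<epsilon> b \<and> rel f c Vc \<and> is_subset x Vc))) \<and>
        rel f a S)"

subsection \<open>Supercompactness\<close>

definition is_Pkappa :: "'v \<Rightarrow> 'v \<Rightarrow> 'v \<Rightarrow> bool" where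
  "is_Pkappa P k X \<longleftrightarrow> (\<forall>A. A \<epsilon> P \<longleftrightarrow> is_subset A X \<and> card_less A k)"

definition is_ultrafilter :: "'v \<Rightarrow> 'v \<Rightarrow> bool" where
  "is_ultrafilter U P \<longleftrightarrow>
     (\<forall>Y. Y \<epsilon> U \<longrightarrow> is_subset Y P) \<and>
     P \<epsilon> U \<and>
     (\<forall>Y. Y \<epsilon> U \<longrightarrow> \<not> is_void Y) \<and>
     (\<forall>Y Z. Y \<epsilon> U \<longrightarrow> is_subset Y Z \<longrightarrow> is_subset Z P \<longrightarrow> Z \<epsilon> U) \<and>
     (\<forall>Y Z W. Y \<epsilon> U \<longrightarrow> Z \<epsilon> U \<longrightarrow> is_inter W Y Z \<longrightarrow> W \<epsilon> U) \<and>
     (\<forall>Y Z. is_subset Y P \<longrightarrow> is_diff Z P Y \<longrightarrow> Y \<epsilon> U \<or> Z \<epsilon> U)"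

definition is_fine :: "'v \<Rightarrow> 'v \<Rightarrow> 'v \<Rightarrow> bool" where
  "is_fine U P X \<longleftrightarrow>
     (\<forall>x Y. x \<epsilon> X \<longrightarrow> (\<forall>A. A \<epsilon> Y \<longleftrightarrow> A \<epsilon> P \<and> x \<epsilon> A) \<longrightarrow> Y \<epsilon> U)"

text \<open>The intersection of the empty family, to be read as the whole underlying set, is covered
  by \<^const>\<open>is_ultrafilter\<close>.\<close>

definition is_complete :: "'v \<Rightarrow> 'v \<Rightarrow> bool" where
  "is_complete k U \<longleftrightarrow>
     (\<forall>S Y. is_subset S U \<longrightarrow> \<not> is_void S \<longrightarrow> card_less S k \<longrightarrow> is_Inter Y S \<longrightarrow> Y \<epsilon> U)"

definition is_normal :: "'v \<Rightarrow> bool" where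
  "is_normal U \<longleftrightarrow>
     (\<forall>f D. D \<epsilon> U \<longrightarrow> function_on f D \<longrightarrow> (\<forall>A y. rel f A y \<longrightarrow> y \<epsilon> A) \<longrightarrow>
        (\<exists>B y. B \<epsilon> U \<and> (\<forall>A. A \<epsilon> B \<longrightarrow> rel f A y)))"

definition is_uncountable_cardinal :: "'v \<Rightarrow> bool" where
  "is_uncountable_cardinal k \<longleftrightarrow> is_cardinal k \<and> \<not> is_countable k"

definition is_supercompact_for :: "'v \<Rightarrow> 'v \<Rightarrow> bool" where
  "is_supercompact_for k X \<longleftrightarrow>
     (\<exists>P U. is_Pkappa P k X \<and> is_ultrafilter U P \<and>
            is_fine U P X \<and> is_complete k U \<and> is_normal U)"

definition is_supercompact :: "'v \<Rightarrow> bool" where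
  "is_supercompact k \<longleftrightarrow> is_uncountable_cardinal k \<and> (\<forall>X. is_supercompact_for k X)"

subsection \<open>Graphs\<close>

definition is_graph :: "'v \<Rightarrow> bool" where
  "is_graph G \<longleftrightarrow>
     (\<exists>V E. is_opair G V E \<and>
        (\<forall>p. p \<epsilon> E \<longrightarrow> (\<exists>v w. v \<epsilon> V \<and> w \<epsilon> V \<and> is_opair p v w)))"

definition is_graph_hom :: "'v \<Rightarrow> 'v \<Rightarrow> 'v \<Rightarrow> bool" where
  "is_graph_hom h G G' \<longleftrightarrow>
     (\<exists>V E V' E'. is_opair G V E \<and> is_opair G' V' E' \<and> maps h V V' \<and>
        (\<forall>v w v' w'. rel E v w \<longrightarrow> rel h v v' \<longrightarrow> rel h w w' \<longrightarrow> rel E' v' w'))"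

definition hom_exists :: "'v \<Rightarrow> 'v \<Rightarrow> bool" where
  "hom_exists G G' \<longleftrightarrow> (\<exists>h. is_graph_hom h G G')"

text \<open>\<open>G\<close> is a sequence, indexed by the ordinals below \<open>k\<close>, of graphs lying in \<open>V\<^sub>k\<close>.\<close>

definition is_graph_sequence :: "'v \<Rightarrow> 'v \<Rightarrow> bool" where
  "is_graph_sequence k G \<longleftrightarrow>
     (\<exists>S. is_vlevel k S \<and> maps G k S) \<and> (\<forall>a Ga. rel G a Ga \<longrightarrow> is_graph Ga)"

end

locale zfc_model = set_lang mem for mem :: "'v \<Rightarrow> 'v \<Rightarrow> bool"  (infix \<open>\<epsilon>\<close> 50) +
  assumes extensionality: "(\<forall>x. x \<epsilon> a \<longleftrightarrow> x \<epsilon> b) \<Longrightarrow> a = b"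
    and pairing: "\<exists>c. is_upair c a b"
    and union: "\<exists>c. \<forall>x. x \<epsilon> c \<longleftrightarrow> (\<exists>y. y \<epsilon> a \<and> x \<epsilon> y)"
    and power_set: "\<exists>c. \<forall>x. x \<epsilon> c \<longleftrightarrow> is_subset x a"
    and infinity: "\<exists>I. is_inductive_set I"
    and foundation: "\<not> is_void a \<Longrightarrow> \<exists>x. x \<epsilon> a \<and> (\<forall>y. y \<epsilon> x \<longrightarrow> \<not> y \<epsilon> a)"
    and separation: "\<exists>b. \<forall>x. x \<epsilon> b \<longleftrightarrow> x \<epsilon> a \<and> sat p (e(0 := x))"
    and replacement:
      "(\<forall>x. x \<epsilon> a \<longrightarrow> (\<exists>!y. sat p (e(0 := x, 1 := y)))) \<Longrightarrow>
       \<exists>b. \<forall>y. y \<epsilon> b \<longleftrightarrow> (\<exists>x. x \<epsilon> a \<and> sat p (e(0 := x, 1 := y)))"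
    and choice:
      "(\<forall>x. x \<epsilon> S \<longrightarrow> \<not> is_void x) \<Longrightarrow>
       (\<forall>x y z. x \<epsilon> S \<longrightarrow> y \<epsilon> S \<longrightarrow> z \<epsilon> x \<longrightarrow> z \<epsilon> y \<longrightarrow> x = y) \<Longrightarrow>
       \<exists>c. \<forall>x. x \<epsilon> S \<longrightarrow> (\<exists>!y. y \<epsilon> x \<and> y \<epsilon> c)"

end

theory Submission
  imports Defs
begin

text \<open>Let \<open>G\<close> be a sequence of graphs in \<open>V\<^sub>\<kappa>\<close> with homomorphisms \<open>G\<^sub>b \<rightarrow> G\<^sub>a\<close> for \<open>a < b < \<kappa>\<close>, and let
  \<open>\<Pi>\<close> be the product of all \<open>G\<^sub>a\<close>. If \<open>j : V \<rightarrow> M\<close> is an elementary embedding with critical point \<open>\<kappa>\<close>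
  and \<open>M\<close> is closed under \<open>|\<Pi>|\<close>-sequences, then \<open>j(G)\<^sub>\<kappa>\<close> maps to every \<open>G\<^sub>a\<close> and hence to \<open>\<Pi>\<close>, while
  \<open>j\<close> restricts to a homomorphism \<open>\<Pi> \<rightarrow> j(\<Pi>)\<close> in \<open>M\<close>, which can be composed with a projection to
  \<open>j(G)\<^sub>b\<close> for some \<open>b > \<kappa>\<close>. By elementarity, there is a homomorphism \<open>G\<^sub>a \<rightarrow> G\<^sub>b\<close> for some
  \<open>a < b < \<kappa>\<close>. The ultrapower is avoided by arguing directly with a normal fine measure \<open>U\<close> on
  \<open>P\<^sub>\<kappa>(X)\<close>, where \<open>X\<close> contains \<open>\<kappa>\<close> and \<open>\<Pi>\<close>: for almost all \<open>A\<close>, with \<open>b\<close> the least element of \<open>\<kappa>\<close>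
  outside \<open>A\<close>, the graph \<open>G\<^sub>b\<close> maps to the product of all \<open>G\<^sub>a\<close> with \<open>a < b\<close>, and restriction to \<open>b\<close> is an
  isomorphism from the subgraph \<open>\<Pi> \<inter> A\<close> onto this product.\<close>

subsection \<open>Definability\<close>

primrec rename :: "(nat \<Rightarrow> nat) \<Rightarrow> fm \<Rightarrow> fm" where
  "rename f (FMem i j) = FMem (f i) (f j)"
| "rename f (FEq i j) = FEq (f i) (f j)"
| "rename f (FNeg p) = FNeg (rename f p)"
| "rename f (FAnd p q) = FAnd (rename f p) (rename f q)"
| "rename f (FAll n p) = FAll (f n) (rename f p)"

context set_lang
begin

text \<open>Bound variables are renamed along with the free ones, so injectivity is what keeps an
  update at \<open>f n\<close> from touching the image of another variable.\<close>

lemma sat_rename: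
  assumes "inj f"
  shows "sat (rename f p) e \<longleftrightarrow> sat p (\<lambda>i. e (f i))"
proof (induction p arbitrary: e)
  case (FAll n p)
  have "(\<lambda>i. (e(f n := x)) (f i)) = (\<lambda>i. e (f i))(n := x)" for x
    using assms by (auto simp: fun_eq_iff dest: injD)
  then show ?case
    using FAll by simp
qed auto

text \<open>Even-numbered variables stand for the arguments, odd-numbered ones for the parameters.\<close>

definition env :: "(nat \<Rightarrow> 'v) \<Rightarrow> (nat \<Rightarrow> 'v) \<Rightarrow> nat \<Rightarrow> 'v" where
  "env e c i = (if even i then e (i div 2) else c (i div 2))"

text \<open>Predicates on environments rather than on tuples: one notion then serves every arity,
  and closure under quantifiers can be stated by shifting indices.\<close>

definition definable :: "((nat \<Rightarrow> 'v) \<Rightarrow> bool) \<Rightarrow> bool" where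
  "definable P \<longleftrightarrow> (\<exists>p c. \<forall>e. P e \<longleftrightarrow> sat p (env e c))"

definition atomic_term :: "((nat \<Rightarrow> 'v) \<Rightarrow> 'v) \<Rightarrow> bool" where
  "atomic_term t \<longleftrightarrow> (\<exists>i. t = (\<lambda>e. e i)) \<or> (\<exists>c. t = (\<lambda>e. c))"

lemma atomic_term_var: "atomic_term (\<lambda>e. e i)"
  unfolding atomic_term_def by blast

lemma atomic_term_const: "atomic_term (\<lambda>e. c)"
  unfolding atomic_term_def by blast

lemma definable_not: "definable P \<Longrightarrow> definable (\<lambda>e. \<not> P e)"
  unfolding definable_def by (metis sat.simps(3))

lemma definable_and:
  assumes "definable P" "definable Q"
  shows "definable (\<lambda>e. P e \<and> Q e)"
proof -
  obtain p c q d where p: "\<And>e. P e \<longleftrightarrow> sat p (env e c)" and q: "\<And>e. Q e \<longleftrightarrow> sat q (env e d)"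
    using assms unfolding definable_def by blast
  \<comment> \<open>\<open>env c d\<close> interleaves the two parameter lists. Both maps fix the
    argument variables; \<open>f\<close> sends parameter n to parameter \<open>2 * n\<close>, and
    \<open>g\<close> sends it to parameter \<open>2 * n + 1\<close>.\<close>
  define f g :: "nat \<Rightarrow> nat" where "f i = (if even i then i else 2 * i - 1)"
    and "g i = (if even i then i else 2 * i + 1)" for i
  have inj: "inj f" "inj g"
    unfolding f_def g_def inj_def by (presburger, presburger)
  have "env e (env c d) (f i) = env e c i \<and> env e (env c d) (g i) = env e d i" for e i
  proof (cases "even i")
    case False
    then obtain n where "i = 2 * n + 1" by (rule oddE)
    then have "f i = Suc (2 * (2 * n))" "g i = Suc (2 * Suc (2 * n))"
      by (simp_all add: f_def g_def)
    then show ?thesis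
      unfolding env_def using \<open>i = 2 * n + 1\<close> by simp
  qed (simp add: env_def f_def g_def)
  then have "sat (FAnd (rename f p) (rename g q)) (env e (env c d)) \<longleftrightarrow> P e \<and> Q e" for e
    by (simp add: sat_rename inj p q)
  then show ?thesis
    unfolding definable_def by metis
qed

text \<open>De Bruijn style: in the premise the quantified element is argument 0 and the other
  arguments have moved up by one.\<close>

lemma definable_all:
  assumes "definable (\<lambda>e. P (\<lambda>i. e (Suc i)) (e 0))"
  shows "definable (\<lambda>e. \<forall>x. P e x)"
proof -
  obtain p c where p: "\<And>e. P (\<lambda>i. e (Suc i)) (e 0) \<longleftrightarrow> sat p (env e c)"
    using assms unfolding definable_def by blast
  \<comment> \<open>Parameters move up one place to free variable 1 for the bound element, and
    arguments move down one place. The freed parameter has the dummy value \<open>undefined\<close>,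
    which the quantifier overwrites.\<close>
  define f :: "nat \<Rightarrow> nat" where
    "f i = (if i = 0 then 1 else if even i then i - 2 else i + 2)" for i
  have inj: "inj f"
    unfolding f_def inj_def by (auto split: if_splits) (presburger | force elim!: evenE)+
  have "(env e (case_nat undefined c))(1 := x) \<circ> f = env (case_nat x e) c" for e x
    by (rule ext) (auto simp: env_def f_def fun_eq_iff elim!: evenE oddE split: nat.splits)
  then have "sat (FAll 1 (rename f p)) (env e (case_nat undefined c)) \<longleftrightarrow> (\<forall>x. P e x)" for e
    using p[of "case_nat _ e"] by (simp add: sat_rename inj comp_def)
  then show ?thesis
    unfolding definable_def by metis
qed

lemma definable_atom:
  assumes "atomic_term t" "atomic_term u"
  shows definable_mem: "definable (\<lambda>e. t e \<epsilon> u e)"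
    and definable_eq: "definable (\<lambda>e. t e = u e)"
proof -
  \<comment> \<open>A constant in \<open>t\<close> becomes variable 1, the first parameter; a
    constant in \<open>u\<close> becomes variable 3, the second.\<close>
  obtain i c j d where "\<And>e. t e = env e (case_nat c d) i" "\<And>e. u e = env e (case_nat c d) j"
  proof -
    obtain i c where 1: "\<And>e d. t e = env e (case_nat c d) i"
    proof (cases "\<exists>i. t = (\<lambda>e. e i)")
      case True
      then obtain i where "t = (\<lambda>e. e i)" by blast
      then show ?thesis by (intro that[of undefined "2 * i"]) (simp add: env_def)
    next
      case False
      then obtain c where "t = (\<lambda>e. c)" using assms unfolding atomic_term_def by blast
      then show ?thesis by (intro that[of c 1]) (simp add: env_def)
    qed
    obtain j d where 2: "\<And>e. u e = env e (case_nat c d) j"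
    proof (cases "\<exists>i. u = (\<lambda>e. e i)")
      case True
      then obtain i where "u = (\<lambda>e. e i)" by blast
      then show ?thesis by (intro that[of undefined "2 * i"]) (simp add: env_def)
    next
      case False
      then obtain d where "u = (\<lambda>e. d)" using assms unfolding atomic_term_def by blast
      then show ?thesis by (intro that[of "\<lambda>_. d" 3]) (simp add: env_def)
    qed
    show ?thesis using that 1 2 by blast
  qed
  then have "sat (FMem i j) (env e (case_nat c d)) \<longleftrightarrow> t e \<epsilon> u e"
    and "sat (FEq i j) (env e (case_nat c d)) \<longleftrightarrow> t e = u e" for e
    by simp_all
  then show "definable (\<lambda>e. t e \<epsilon> u e)" "definable (\<lambda>e. t e = u e)"
    unfolding definable_def by metis+
qed

lemma definable_const: "definable (\<lambda>e. b)"
  using definable_eq[OF atomic_term_const atomic_term_const, of undefined undefined]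
    definable_not by (cases b) fastforce+

lemma definable_or: "definable P \<Longrightarrow> definable Q \<Longrightarrow> definable (\<lambda>e. P e \<or> Q e)"
  using definable_not[OF definable_and[OF definable_not definable_not]] by simp

lemma definable_imp: "definable P \<Longrightarrow> definable Q \<Longrightarrow> definable (\<lambda>e. P e \<longrightarrow> Q e)"
  using definable_not[OF definable_and[OF _ definable_not]] by simp

lemma definable_iff: "definable P \<Longrightarrow> definable Q \<Longrightarrow> definable (\<lambda>e. P e \<longleftrightarrow> Q e)"
  using definable_and[OF definable_imp definable_imp, of P Q Q P]
  by (simp add: iff_conv_conj_imp)

lemma definable_ex:
  "definable (\<lambda>e. P (\<lambda>i. e (Suc i)) (e 0)) \<Longrightarrow> definable (\<lambda>e. \<exists>x. P e x)"
  using definable_not[OF definable_all[of "\<lambda>e x. \<not> P e x", OF definable_not]] by simp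

text \<open>Applied backwards to a predicate unfolded to membership and equality, these rules prove
  definability without an explicit formula.\<close>

lemmas definable_intros = definable_const definable_not definable_and definable_or definable_imp
  definable_iff definable_all definable_ex definable_mem definable_eq
  atomic_term_var atomic_term_const

lemmas basic_defs = is_subset_def is_upair_def is_opair_def rel_def

end

context zfc_model
begin

text \<open>The bridge from HOL predicates to the first-order scheme. Variable 0, over which
  Separation ranges, is argument 0 of \<open>env\<close>, so the formula behind \<open>Q\<close> can
  be used as it is.\<close>

lemma separation_definable:
  assumes "definable (\<lambda>e. Q (e 0))"
  obtains b where "\<And>x. x \<epsilon> b \<longleftrightarrow> x \<epsilon> a \<and> Q x"
proof -
  obtain p c where p: "\<And>e. Q (e 0) \<longleftrightarrow> sat p (env e c)"
    using assms unfolding definable_def by blast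
  have "(env undefined c)(0 := x) = env (undefined(0 := x)) c" for x
    by (auto simp: env_def fun_eq_iff)
  then have "sat p ((env undefined c)(0 := x)) \<longleftrightarrow> Q x" for x
    using p[of "undefined(0 := x)"] by simp
  then show ?thesis
    using separation[of a p "env undefined c"] that by auto
qed

subsection \<open>Pairs, relations and choice\<close>

lemma is_upair_unique: "is_upair p x y \<Longrightarrow> is_upair q x y \<Longrightarrow> p = q"
  unfolding is_upair_def by (blast intro: extensionality)

lemma is_opair_unique: "is_opair p x y \<Longrightarrow> is_opair q x y \<Longrightarrow> p = q"
  unfolding is_opair_def by (metis is_upair_unique)

lemma is_opair_exists: "\<exists>p. is_opair p x y"
  unfolding is_opair_def using pairing by blast

lemma is_upair_inject: "is_upair p x y \<Longrightarrow> is_upair p x' y' \<Longrightarrow> x = x' \<and> y = y' \<or> x = y' \<and> y = x'"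
  unfolding is_upair_def by metis

lemma is_opair_inject:
  assumes "is_opair p x y" "is_opair p x' y'"
  shows "x = x' \<and> y = y'"
proof -
  obtain a b a' b' where *: "is_upair a x x" "is_upair b x y" "is_upair p a b"
    "is_upair a' x' x'" "is_upair b' x' y'" "is_upair p a' b'"
    using assms unfolding is_opair_def by blast
  then consider "a = a'" "b = b'" | "a = b'" "b = a'"
    using is_upair_inject by blast
  then show ?thesis
    using * is_upair_inject by cases metis+
qed

text \<open>The first coordinate sits two membership steps below the pair. This later bounds the
  vertex set of a graph, both by unions and by levels of the hierarchy.\<close>

lemma is_opairE:
  assumes "is_opair p x y"
  obtains q where "q \<epsilon> p" "x \<epsilon> q"
  using assms unfolding is_opair_def is_upair_def by metis

text \<open>Kuratowski pairs over \<open>a\<close> and \<open>b\<close> lie in the double power set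
  of the union of \<open>a\<close> and \<open>b\<close>, from which Separation cuts out the
  product.\<close>

lemma product_exists: "\<exists>c. \<forall>p. p \<epsilon> c \<longleftrightarrow> (\<exists>x y. x \<epsilon> a \<and> y \<epsilon> b \<and> is_opair p x y)"
proof -
  obtain ab where ab: "is_upair ab a b"
    using pairing by blast
  obtain u where "\<And>x. x \<epsilon> u \<longleftrightarrow> (\<exists>y. y \<epsilon> ab \<and> x \<epsilon> y)"
    using union by metis
  then have u: "x \<epsilon> u \<longleftrightarrow> x \<epsilon> a \<or> x \<epsilon> b" for x
    using ab unfolding is_upair_def by auto
  obtain v where v: "\<And>x. x \<epsilon> v \<longleftrightarrow> is_subset x u"
    using power_set by metis
  obtain w where w: "\<And>x. x \<epsilon> w \<longleftrightarrow> is_subset x v"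
    using power_set by metis
  have "definable (\<lambda>e. \<exists>x y. x \<epsilon> a \<and> y \<epsilon> b \<and> is_opair (e 0) x y)"
    unfolding basic_defs by (intro definable_intros)
  then obtain c where c: "\<And>p. p \<epsilon> c \<longleftrightarrow> p \<epsilon> w \<and> (\<exists>x y. x \<epsilon> a \<and> y \<epsilon> b \<and> is_opair p x y)"
    by (rule separation_definable[where a = w]) blast
  have "p \<epsilon> w" if "x \<epsilon> a" "y \<epsilon> b" "is_opair p x y" for p x y
    using that unfolding is_opair_def is_upair_def w is_subset_def v u by metis
  then show ?thesis
    using c by blast
qed

text \<open>Definability is required at all indices because every quantifier that is passed shifts
  them. The second conclusion, that \<open>r\<close> contains only pairs, is what
  \<open>function_on\<close> later asks for.\<close>

lemma relation_exists:
  assumes "\<And>i j. definable (\<lambda>e. Q (e i) (e j))"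
  obtains r where "\<And>x y. rel r x y \<longleftrightarrow> x \<epsilon> a \<and> y \<epsilon> b \<and> Q x y"
    and "\<And>p. p \<epsilon> r \<Longrightarrow> \<exists>x y. x \<epsilon> a \<and> y \<epsilon> b \<and> is_opair p x y"
proof -
  obtain c where c: "\<And>p. p \<epsilon> c \<longleftrightarrow> (\<exists>x y. x \<epsilon> a \<and> y \<epsilon> b \<and> is_opair p x y)"
    using product_exists by metis
  have "definable (\<lambda>e. \<exists>x y. is_opair (e 0) x y \<and> Q x y)"
    unfolding basic_defs by (intro definable_intros assms)
  then obtain r where r: "\<And>p. p \<epsilon> r \<longleftrightarrow> p \<epsilon> c \<and> (\<exists>x y. is_opair p x y \<and> Q x y)"
    by (rule separation_definable[where a = c]) blast
  show ?thesis
  proof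
    show "rel r x y \<longleftrightarrow> x \<epsilon> a \<and> y \<epsilon> b \<and> Q x y" for x y
      unfolding rel_def r c using is_opair_exists[of x y] by (auto dest: is_opair_inject)
  qed (use r c in blast)
qed

text \<open>The axiom of choice concerns disjoint families. The fibres of \<open>r\<close>, kept as
  sets of pairs, are disjoint because a pair remembers its first coordinate; a transversal
  \<open>c\<close> of them, cut down to \<open>r\<close>, is the function.\<close>

lemma choice_function:
  assumes "\<And>i j. definable (\<lambda>e. Q (e i) (e j))" and "\<And>x. x \<epsilon> a \<Longrightarrow> \<exists>y. y \<epsilon> b \<and> Q x y"
  obtains f where "function_on f a" and "\<And>x y. rel f x y \<Longrightarrow> x \<epsilon> a \<and> y \<epsilon> b \<and> Q x y"
proof -
  obtain r where r: "\<And>x y. rel r x y \<longleftrightarrow> x \<epsilon> a \<and> y \<epsilon> b \<and> Q x y"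
    and rp: "\<And>p. p \<epsilon> r \<Longrightarrow> \<exists>x y. x \<epsilon> a \<and> y \<epsilon> b \<and> is_opair p x y"
    by (rule relation_exists[of Q a b, OF assms(1)]) blast
  obtain q where q: "\<And>z. z \<epsilon> q \<longleftrightarrow> is_subset z r"
    using power_set by metis
  have "definable (\<lambda>e. \<exists>x. x \<epsilon> a \<and> (\<forall>p. p \<epsilon> e 0 \<longleftrightarrow> p \<epsilon> r \<and> (\<exists>y. is_opair p x y)))"
    unfolding basic_defs by (intro definable_intros)
  then obtain S where "\<And>z. z \<epsilon> S \<longleftrightarrow> z \<epsilon> q \<and>
      (\<exists>x. x \<epsilon> a \<and> (\<forall>p. p \<epsilon> z \<longleftrightarrow> p \<epsilon> r \<and> (\<exists>y. is_opair p x y)))"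
    by (rule separation_definable[where a = q]) blast
  then have S: "z \<epsilon> S \<longleftrightarrow> (\<exists>x. x \<epsilon> a \<and> (\<forall>p. p \<epsilon> z \<longleftrightarrow> p \<epsilon> r \<and> (\<exists>y. is_opair p x y)))" for z
    unfolding q is_subset_def by blast
  have fibre: "\<exists>z. \<forall>p. p \<epsilon> z \<longleftrightarrow> p \<epsilon> r \<and> (\<exists>y. is_opair p x y)" for x
  proof -
    have "definable (\<lambda>e. \<exists>y. is_opair (e 0) x y)"
      unfolding basic_defs by (intro definable_intros)
    then show ?thesis by (rule separation_definable[where a = r]) blast
  qed
  have "\<exists>c. \<forall>x. x \<epsilon> S \<longrightarrow> (\<exists>!y. y \<epsilon> x \<and> y \<epsilon> c)"
  proof (rule choice; intro allI impI)
    fix z assume "z \<epsilon> S"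
    then obtain x where x: "x \<epsilon> a" "\<forall>p. p \<epsilon> z \<longleftrightarrow> p \<epsilon> r \<and> (\<exists>y. is_opair p x y)"
      using S by blast
    then obtain y where "rel r x y"
      using assms(2) r by blast
    then show "\<not> is_void z"
      using x unfolding is_void_def rel_def by blast
  next
    fix z z' p assume "z \<epsilon> S" "z' \<epsilon> S" "p \<epsilon> z" "p \<epsilon> z'"
    then obtain x x' where "\<forall>p. p \<epsilon> z \<longleftrightarrow> p \<epsilon> r \<and> (\<exists>y. is_opair p x y)"
      "\<forall>p. p \<epsilon> z' \<longleftrightarrow> p \<epsilon> r \<and> (\<exists>y. is_opair p x' y)" "x = x'"
      using S is_opair_inject by metis
    then show "z = z'"
      by (intro extensionality) blast
  qed
  then obtain c where c: "\<And>z. z \<epsilon> S \<Longrightarrow> \<exists>!p. p \<epsilon> z \<and> p \<epsilon> c"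
    by blast
  obtain f where f: "\<And>p. p \<epsilon> f \<longleftrightarrow> p \<epsilon> r \<and> p \<epsilon> c"
    by (rule separation_definable[of "\<lambda>p. p \<epsilon> c" r]) (auto intro: definable_intros)
  have unique: "\<exists>!y. rel f x y" if "x \<epsilon> a" for x
  proof -
    obtain z where z: "\<And>p. p \<epsilon> z \<longleftrightarrow> p \<epsilon> r \<and> (\<exists>y. is_opair p x y)"
      using fibre by metis
    then have "z \<epsilon> S"
      using S that by blast
    then obtain p where p: "p \<epsilon> z" "p \<epsilon> c" "\<And>p'. p' \<epsilon> z \<Longrightarrow> p' \<epsilon> c \<Longrightarrow> p' = p"
      using c by metis
    obtain y where y: "is_opair p x y"
      using p z by blast
    show ?thesis
    proof
      show "rel f x y"
        unfolding rel_def f using p z y by blast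
    next
      fix y' assume "rel f x y'"
      then obtain p' where "is_opair p' x y'" "p' \<epsilon> r" "p' \<epsilon> c"
        unfolding rel_def f by blast
      then show "y' = y"
        using p(3) z y is_opair_inject by blast
    qed
  qed
  have sub: "rel f x y \<Longrightarrow> rel r x y" for x y
    unfolding rel_def f by blast
  show ?thesis
  proof
    show "function_on f a"
      unfolding function_on_def using f rp unique sub r by blast
  qed (use sub r in blast)
qed

lemma function_onD:
  assumes "function_on f a"
  shows "x \<epsilon> a \<Longrightarrow> \<exists>y. rel f x y" "rel f x y \<Longrightarrow> x \<epsilon> a" "rel f x y \<Longrightarrow> rel f x y' \<Longrightarrow> y = y'"
  using assms unfolding function_on_def by blast+

subsection \<open>Ordinals and cardinals\<close>

lemma minimal_element:
  assumes "definable (\<lambda>e. Q (e 0))" "x \<epsilon> a" "Q x"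
  obtains m where "m \<epsilon> a" "Q m" "\<And>z. z \<epsilon> m \<Longrightarrow> z \<epsilon> a \<Longrightarrow> \<not> Q z"
proof -
  obtain b where b: "\<And>x. x \<epsilon> b \<longleftrightarrow> x \<epsilon> a \<and> Q x"
    using separation_definable[OF assms(1)] by metis
  then have "\<not> is_void b"
    using assms unfolding is_void_def by blast
  then show ?thesis
    using foundation b that by metis
qed

lemma mem_irrefl: "\<not> x \<epsilon> x"
proof
  assume x: "x \<epsilon> x"
  have "definable (\<lambda>e. e 0 = x)"
    by (intro definable_intros)
  then obtain m where "m = x" "\<And>z. z \<epsilon> m \<Longrightarrow> z \<epsilon> x \<Longrightarrow> z \<noteq> x"
    using minimal_element[of "\<lambda>z. z = x" x x] x by metis
  then show False
    using x by blast
qed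

lemma ordinal_mem_transitive: "is_ordinal k \<Longrightarrow> x \<epsilon> y \<Longrightarrow> y \<epsilon> k \<Longrightarrow> x \<epsilon> k"
  unfolding is_ordinal_def is_transitive_def is_subset_def by blast

lemma ordinal_mem_mem_transitive: "is_ordinal k \<Longrightarrow> x \<epsilon> y \<Longrightarrow> y \<epsilon> z \<Longrightarrow> z \<epsilon> k \<Longrightarrow> x \<epsilon> z"
  unfolding is_ordinal_def is_transitive_def is_subset_def by blast

lemma ordinal_mem: "is_ordinal k \<Longrightarrow> x \<epsilon> k \<Longrightarrow> is_ordinal x"
  unfolding is_ordinal_def is_transitive_def is_subset_def by blast

text \<open>Take a minimal \<open>m\<close> incomparable with some element of \<open>k\<close>, and
  a minimal \<open>n\<close> incomparable with \<open>m\<close>. Minimality forces \<open>m\<close>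
  and \<open>n\<close> to have the same elements, hence to be equal.\<close>

lemma ordinal_linear:
  assumes k: "is_ordinal k" and "x \<epsilon> k" "y \<epsilon> k"
  shows "x \<epsilon> y \<or> x = y \<or> y \<epsilon> x"
proof (rule ccontr)
  define Q where "Q x y \<longleftrightarrow> \<not> (x \<epsilon> y \<or> x = y \<or> y \<epsilon> x)" for x y
  assume "\<not> ?thesis"
  then have ex: "\<exists>y. y \<epsilon> k \<and> Q x y"
    using assms unfolding Q_def by blast
  have "definable (\<lambda>e. \<exists>y. y \<epsilon> k \<and> Q (e 0) y)"
    unfolding Q_def by (intro definable_intros)
  then obtain m where m: "m \<epsilon> k" "\<exists>y. y \<epsilon> k \<and> Q m y"
    and min: "\<And>z. z \<epsilon> m \<Longrightarrow> z \<epsilon> k \<Longrightarrow> \<not> (\<exists>y. y \<epsilon> k \<and> Q z y)"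
    by (rule minimal_element[of "\<lambda>x. \<exists>y. y \<epsilon> k \<and> Q x y" x k, OF _ \<open>x \<epsilon> k\<close> ex]) blast
  obtain y where y: "y \<epsilon> k" "Q m y"
    using m by blast
  have "definable (\<lambda>e. Q m (e 0))"
    unfolding Q_def by (intro definable_intros)
  then obtain n where n: "n \<epsilon> k" "Q m n" and min': "\<And>z. z \<epsilon> n \<Longrightarrow> z \<epsilon> k \<Longrightarrow> \<not> Q m z"
    by (rule minimal_element[of "Q m" y k, OF _ y]) blast
  have "z \<epsilon> m \<longleftrightarrow> z \<epsilon> n" for z
  proof
    assume z: "z \<epsilon> m"
    then have "z \<epsilon> k"
      using ordinal_mem_transitive[OF k] m(1) by blast
    then have "z \<epsilon> n \<or> z = n \<or> n \<epsilon> z"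
      using min[OF z] n(1) unfolding Q_def by blast
    then show "z \<epsilon> n"
      using n(2) z ordinal_mem_mem_transitive[OF k _ z m(1)] unfolding Q_def by blast
  next
    assume z: "z \<epsilon> n"
    then have "z \<epsilon> k"
      using ordinal_mem_transitive[OF k] n(1) by blast
    then have "m \<epsilon> z \<or> m = z \<or> z \<epsilon> m"
      using min'[OF z] unfolding Q_def by blast
    then show "z \<epsilon> m"
      using n(2) z ordinal_mem_mem_transitive[OF k _ z n(1)] unfolding Q_def by blast
  qed
  then have "m = n"
    by (blast intro: extensionality)
  then show False
    using n unfolding Q_def by blast
qed

section \<open>Equipotence and comparison with a cardinal\<close>

lemma equipotentI:
  assumes "\<And>i j. definable (\<lambda>e. Q (e i) (e j))"
    and "\<And>x. x \<epsilon> a \<Longrightarrow> \<exists>y. y \<epsilon> b \<and> Q x y" "\<And>y. y \<epsilon> b \<Longrightarrow> \<exists>x. x \<epsilon> a \<and> Q x y"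
    and "\<And>x y x' y'. x \<epsilon> a \<Longrightarrow> y \<epsilon> b \<Longrightarrow> x' \<epsilon> a \<Longrightarrow> y' \<epsilon> b \<Longrightarrow> Q x y \<Longrightarrow> Q x' y' \<Longrightarrow> x = x' \<longleftrightarrow> y = y'"
  shows "equipotent a b"
proof -
  obtain r where r: "\<And>x y. rel r x y \<longleftrightarrow> x \<epsilon> a \<and> y \<epsilon> b \<and> Q x y"
    and rp: "\<And>p. p \<epsilon> r \<Longrightarrow> \<exists>x y. x \<epsilon> a \<and> y \<epsilon> b \<and> is_opair p x y"
    by (rule relation_exists[of Q a b, OF assms(1)]) blast
  have "y = y'" if "rel r x y" "rel r x y'" for x y y'
    using that assms(4)[of x y x y'] r by blast
  then have "function_on r a"
    unfolding function_on_def using r rp assms(2) by meson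
  moreover have "x = x'" if "rel r x y" "rel r x' y" for x x' y
    using that assms(4)[of x y x' y] r by blast
  ultimately have "is_bijection r a b"
    unfolding is_bijection_def is_injection_def maps_def using r assms(3) by meson
  then show ?thesis
    unfolding equipotent_def by blast
qed

lemma equipotentE:
  assumes "equipotent a b"
  obtains f where "\<And>x y. rel f x y \<Longrightarrow> x \<epsilon> a \<and> y \<epsilon> b"
    and "\<And>x. x \<epsilon> a \<Longrightarrow> \<exists>y. rel f x y" "\<And>y. y \<epsilon> b \<Longrightarrow> \<exists>x. rel f x y"
    and "\<And>x y x' y'. rel f x y \<Longrightarrow> rel f x' y' \<Longrightarrow> x = x' \<longleftrightarrow> y = y'"
proof -
  obtain f where f: "function_on f a" "\<And>x y. rel f x y \<Longrightarrow> y \<epsilon> b"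
    "\<And>x x' y. rel f x y \<Longrightarrow> rel f x' y \<Longrightarrow> x = x'" "\<And>y. y \<epsilon> b \<Longrightarrow> \<exists>x. rel f x y"
    using assms unfolding equipotent_def is_bijection_def is_injection_def maps_def by blast
  show ?thesis
    by (rule that[of f]) (use f function_onD[OF f(1)] in blast)+
qed

lemma equipotent_sym:
  assumes "equipotent a b"
  shows "equipotent b a"
proof -
  obtain f where f: "\<And>x y. rel f x y \<Longrightarrow> x \<epsilon> a \<and> y \<epsilon> b"
    and "\<And>x. x \<epsilon> a \<Longrightarrow> \<exists>y. rel f x y" "\<And>y. y \<epsilon> b \<Longrightarrow> \<exists>x. rel f x y"
    and "\<And>x y x' y'. rel f x y \<Longrightarrow> rel f x' y' \<Longrightarrow> x = x' \<longleftrightarrow> y = y'"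
    using equipotentE[OF assms] by blast
  moreover have "definable (\<lambda>e. rel f (e j) (e i))" for i j
    unfolding basic_defs by (intro definable_intros)
  ultimately show ?thesis
    by (intro equipotentI[of "\<lambda>x y. rel f y x"]) blast+
qed

lemma equipotent_trans:
  assumes "equipotent a b" "equipotent b c"
  shows "equipotent a c"
proof -
  obtain f where f: "\<And>x y. rel f x y \<Longrightarrow> x \<epsilon> a \<and> y \<epsilon> b"
    "\<And>x. x \<epsilon> a \<Longrightarrow> \<exists>y. rel f x y" "\<And>y. y \<epsilon> b \<Longrightarrow> \<exists>x. rel f x y"
    and finj: "\<And>x y x' y'. rel f x y \<Longrightarrow> rel f x' y' \<Longrightarrow> x = x' \<longleftrightarrow> y = y'"
    using equipotentE[OF assms(1)] by blast
  obtain g where g: "\<And>x y. rel g x y \<Longrightarrow> x \<epsilon> b \<and> y \<epsilon> c"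
    "\<And>x. x \<epsilon> b \<Longrightarrow> \<exists>y. rel g x y" "\<And>y. y \<epsilon> c \<Longrightarrow> \<exists>x. rel g x y"
    and ginj: "\<And>x y x' y'. rel g x y \<Longrightarrow> rel g x' y' \<Longrightarrow> x = x' \<longleftrightarrow> y = y'"
    using equipotentE[OF assms(2)] by blast
  show ?thesis
  proof (rule equipotentI[of "\<lambda>x z. \<exists>y. rel f x y \<and> rel g y z"])
    show "definable (\<lambda>e. \<exists>y. rel f (e i) y \<and> rel g y (e j))" for i j
      unfolding basic_defs by (intro definable_intros)
    show "\<exists>z. z \<epsilon> c \<and> (\<exists>y. rel f x y \<and> rel g y z)" if "x \<epsilon> a" for x
      using f(1) f(2)[OF that] g(1,2) by blast
    show "\<exists>x. x \<epsilon> a \<and> (\<exists>y. rel f x y \<and> rel g y z)" if "z \<epsilon> c" for z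
      using g(1) g(3)[OF that] f(1,3) by blast
    fix x z x' z'
    assume "\<exists>y. rel f x y \<and> rel g y z" "\<exists>y. rel f x' y \<and> rel g y z'"
    then obtain y y' where "rel f x y" "rel g y z" "rel f x' y'" "rel g y' z'"
      by blast
    then show "x = x' \<longleftrightarrow> z = z'"
      using finj[of x y x' y'] ginj[of y z y' z'] by blast
  qed
qed

lemma definable_equipotent: "definable (\<lambda>e. equipotent a (e i))"
  unfolding equipotent_def is_bijection_def is_injection_def maps_def function_on_def basic_defs
  by (intro definable_intros)

lemma equipotent_refl: "equipotent a a"
  by (rule equipotentI[of "\<lambda>x y. x = y"]) (auto intro: definable_intros)

text \<open>The least element of \<open>k\<close> equipotent with \<open>b\<close> is a cardinal,
  since a smaller ordinal in bijection with it would also be equipotent with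
  \<open>b\<close>.\<close>

lemma card_less_mem:
  assumes k: "is_ordinal k" and "b \<epsilon> k"
  shows "card_less b k"
proof -
  obtain c where c: "c \<epsilon> k" "equipotent b c"
    and min: "\<And>z. z \<epsilon> c \<Longrightarrow> z \<epsilon> k \<Longrightarrow> \<not> equipotent b z"
    using minimal_element[of "equipotent b" b k, OF definable_equipotent \<open>b \<epsilon> k\<close> equipotent_refl]
    by metis
  have "is_cardinal c"
    unfolding is_cardinal_def
    using c min ordinal_mem[OF k] ordinal_mem_transitive[OF k] equipotent_trans equipotent_sym
    by blast
  then show ?thesis
    unfolding card_less_def using c by blast
qed

lemma card_less_equipotent: "card_less b k \<Longrightarrow> equipotent a b \<Longrightarrow> card_less a k"
  unfolding card_less_def using equipotent_trans by blast

text \<open>A bijection \<open>f\<close> from a superset \<open>a\<close> of \<open>k\<close> onto some \<open>c\<close> below \<open>k\<close> would give, as in the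
  Schroeder--Bernstein theorem, a bijection from \<open>a\<close> onto \<open>k\<close>: apply \<open>f\<close> on the closure \<open>z\<close> of
  the complement of \<open>k\<close> under \<open>f\<close>, and the identity elsewhere.\<close>

lemma not_card_less_superset:
  assumes k: "is_cardinal k" and "is_subset k a"
  shows "\<not> card_less a k"
proof
  assume "card_less a k"
  then obtain c where c: "equipotent a c" "c \<epsilon> k"
    unfolding card_less_def by blast
  have ord: "is_ordinal k"
    using k unfolding is_cardinal_def by blast
  obtain f where f: "\<And>x y. rel f x y \<Longrightarrow> x \<epsilon> a \<and> y \<epsilon> c"
    and ftot: "\<And>x. x \<epsilon> a \<Longrightarrow> \<exists>y. rel f x y"
    and finj: "\<And>x y x' y'. rel f x y \<Longrightarrow> rel f x' y' \<Longrightarrow> x = x' \<longleftrightarrow> y = y'"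
    using equipotentE[OF c(1)] by metis
  have ck: "x \<epsilon> k" if "x \<epsilon> c" for x
    using ordinal_mem_transitive[OF ord that c(2)] .
  have ka: "x \<epsilon> a" if "x \<epsilon> k" for x
    using assms(2) that unfolding is_subset_def by blast
  define closed where
    "closed z \<longleftrightarrow> (\<forall>x. x \<epsilon> a \<longrightarrow> \<not> x \<epsilon> k \<longrightarrow> x \<epsilon> z) \<and> (\<forall>x y. x \<epsilon> z \<longrightarrow> rel f x y \<longrightarrow> y \<epsilon> z)" for z
  have "definable (\<lambda>e. \<forall>z. closed z \<longrightarrow> e 0 \<epsilon> z)"
    unfolding closed_def basic_defs by (intro definable_intros)
  then obtain z where z: "\<And>x. x \<epsilon> z \<longleftrightarrow> x \<epsilon> a \<and> (\<forall>z. closed z \<longrightarrow> x \<epsilon> z)"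
    by (rule separation_definable[where a = a]) blast
  have z1: "x \<epsilon> z" if "x \<epsilon> a" "\<not> x \<epsilon> k" for x
    using that z unfolding closed_def by blast
  have z2: "y \<epsilon> z" if "x \<epsilon> z" "rel f x y" for x y
    using that z f ck ka unfolding closed_def by blast
  \<comment> \<open>The closure \<open>z\<close> is the least closed set: a point \<open>y\<close>
    that is in \<open>k\<close> and is not hit by \<open>f\<close> from \<open>z\<close> could be
    removed from it.\<close>
  have z3: "\<exists>x. x \<epsilon> z \<and> rel f x y" if "y \<epsilon> z" "y \<epsilon> k" for y
  proof (rule ccontr)
    assume no: "\<not> ?thesis"
    have "definable (\<lambda>e. e 0 \<noteq> y)"
      by (intro definable_intros)
    then obtain z' where z': "\<And>x. x \<epsilon> z' \<longleftrightarrow> x \<epsilon> z \<and> x \<noteq> y"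
      by (rule separation_definable[where a = z]) blast
    have "closed z'"
      unfolding closed_def z' using no z1 z2 that by blast
    then show False
      using that z z' by blast
  qed
  have "equipotent a k"
  proof (rule equipotentI[of "\<lambda>x y. x \<epsilon> z \<and> rel f x y \<or> \<not> x \<epsilon> z \<and> y = x"])
    show "definable (\<lambda>e. e i \<epsilon> z \<and> rel f (e i) (e j) \<or> \<not> e i \<epsilon> z \<and> e j = e i)" for i j
      unfolding basic_defs by (intro definable_intros)
    show "\<exists>y. y \<epsilon> k \<and> (x \<epsilon> z \<and> rel f x y \<or> \<not> x \<epsilon> z \<and> y = x)" if "x \<epsilon> a" for x
      using that ftot f ck z1 by metis
    show "\<exists>x. x \<epsilon> a \<and> (x \<epsilon> z \<and> rel f x y \<or> \<not> x \<epsilon> z \<and> y = x)" if "y \<epsilon> k" for y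
      using that z3 ka z by metis
  qed (use finj z2 in metis)
  then show False
    using c k equipotent_trans equipotent_sym unfolding is_cardinal_def by blast
qed

end

subsection \<open>Normal measures\<close>

locale normal_measure = zfc_model mem for mem :: "'v \<Rightarrow> 'v \<Rightarrow> bool"  (infix \<open>\<epsilon>\<close> 50) +
  fixes \<kappa> X P U :: 'v
  assumes cardinal: "is_cardinal \<kappa>"
    and subset_X: "is_subset \<kappa> X"
    and Pkappa: "is_Pkappa P \<kappa> X"
    and ultrafilter: "is_ultrafilter U P"
    and fineness: "is_fine U P X"
    and completeness: "is_complete \<kappa> U"
    and normality: "is_normal U"
begin

lemma ordinal: "is_ordinal \<kappa>"
  using cardinal unfolding is_cardinal_def by blast

section \<open>Quantification over almost all sets\<close>

text \<open>The quantifier "for almost all \<open>A\<close>". Being stated through a witness in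
  \<open>U\<close>, it makes sense for predicates that define no set; definability is asked for only
  where such a set has to be formed.\<close>

definition ae :: "('v \<Rightarrow> bool) \<Rightarrow> bool" where
  "ae Q \<longleftrightarrow> (\<exists>Y. Y \<epsilon> U \<and> (\<forall>A. A \<epsilon> Y \<longrightarrow> Q A))"

lemma
  shows U_subset: "Y \<epsilon> U \<Longrightarrow> A \<epsilon> Y \<Longrightarrow> A \<epsilon> P"
    and U_nonvoid: "Y \<epsilon> U \<Longrightarrow> \<exists>A. A \<epsilon> Y"
    and U_upward: "Y \<epsilon> U \<Longrightarrow> is_subset Y Z \<Longrightarrow> is_subset Z P \<Longrightarrow> Z \<epsilon> U"
    and U_inter: "Y \<epsilon> U \<Longrightarrow> Z \<epsilon> U \<Longrightarrow> is_inter W Y Z \<Longrightarrow> W \<epsilon> U"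
    and U_diff: "is_subset Y P \<Longrightarrow> is_diff Z P Y \<Longrightarrow> Y \<epsilon> U \<or> Z \<epsilon> U"
proof -
  note u = ultrafilter[unfolded is_ultrafilter_def]
  show "Y \<epsilon> U \<Longrightarrow> A \<epsilon> Y \<Longrightarrow> A \<epsilon> P"
    using u[THEN conjunct1] unfolding is_subset_def by blast
  show "Y \<epsilon> U \<Longrightarrow> \<exists>A. A \<epsilon> Y"
    using u[THEN conjunct2, THEN conjunct2, THEN conjunct1] unfolding is_void_def by blast
  note u' = u[THEN conjunct2, THEN conjunct2, THEN conjunct2]
  show "Y \<epsilon> U \<Longrightarrow> is_subset Y Z \<Longrightarrow> is_subset Z P \<Longrightarrow> Z \<epsilon> U"
    using u'[THEN conjunct1] by blast
  show "Y \<epsilon> U \<Longrightarrow> Z \<epsilon> U \<Longrightarrow> is_inter W Y Z \<Longrightarrow> W \<epsilon> U"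
    using u'[THEN conjunct2, THEN conjunct1] by blast
  show "is_subset Y P \<Longrightarrow> is_diff Z P Y \<Longrightarrow> Y \<epsilon> U \<or> Z \<epsilon> U"
    using u'[THEN conjunct2, THEN conjunct2] by blast
qed

lemma ae_U: "Y \<epsilon> U \<Longrightarrow> ae (\<lambda>A. A \<epsilon> Y)"
  unfolding ae_def by blast

lemma ae_mono: "ae Q \<Longrightarrow> (\<And>A. A \<epsilon> P \<Longrightarrow> Q A \<Longrightarrow> R A) \<Longrightarrow> ae R"
  unfolding ae_def using U_subset by meson

lemma ae_ex: "ae Q \<Longrightarrow> \<exists>A. A \<epsilon> P \<and> Q A"
  unfolding ae_def using U_subset U_nonvoid by meson

lemma ae_conj:
  assumes "ae Q" "ae R"
  shows "ae (\<lambda>A. Q A \<and> R A)"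
proof -
  obtain Y Z where YZ: "Y \<epsilon> U" "Z \<epsilon> U" "\<And>A. A \<epsilon> Y \<Longrightarrow> Q A" "\<And>A. A \<epsilon> Z \<Longrightarrow> R A"
    using assms unfolding ae_def by blast
  have "definable (\<lambda>e. e 0 \<epsilon> Z)"
    by (intro definable_intros)
  then obtain W where W: "\<And>A. A \<epsilon> W \<longleftrightarrow> A \<epsilon> Y \<and> A \<epsilon> Z"
    by (rule separation_definable[where a = Y]) blast
  then have "W \<epsilon> U"
    by (intro U_inter[OF YZ(1,2)]) (simp add: is_inter_def)
  then show ?thesis
    unfolding ae_def using YZ W by blast
qed

lemma ae_set:
  assumes "definable (\<lambda>e. Q (e 0))"
  obtains Y where "\<And>A. A \<epsilon> Y \<longleftrightarrow> A \<epsilon> P \<and> Q A" "Y \<epsilon> U \<longleftrightarrow> ae Q"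
proof -
  obtain Y where Y: "\<And>A. A \<epsilon> Y \<longleftrightarrow> A \<epsilon> P \<and> Q A"
    by (rule separation_definable[of Q P, OF assms]) blast
  have "Y \<epsilon> U" if "Z \<epsilon> U" "\<And>A. A \<epsilon> Z \<Longrightarrow> Q A" for Z
  proof -
    have "is_subset Z Y" "is_subset Y P"
      unfolding is_subset_def using Y that U_subset by blast+
    then show ?thesis
      using U_upward that by blast
  qed
  then have "Y \<epsilon> U \<longleftrightarrow> ae Q"
    using Y unfolding ae_def by blast
  with Y show ?thesis
    by (rule that)
qed

lemma ae_dichotomy:
  assumes "definable (\<lambda>e. Q (e 0))"
  shows "ae Q \<or> ae (\<lambda>A. \<not> Q A)"
proof -
  obtain Y where Y: "\<And>A. A \<epsilon> Y \<longleftrightarrow> A \<epsilon> P \<and> Q A" "Y \<epsilon> U \<longleftrightarrow> ae Q"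
    by (rule ae_set[of Q, OF assms]) blast
  obtain Z where Z: "\<And>A. A \<epsilon> Z \<longleftrightarrow> A \<epsilon> P \<and> \<not> Q A" "Z \<epsilon> U \<longleftrightarrow> ae (\<lambda>A. \<not> Q A)"
    by (rule ae_set[of "\<lambda>A. \<not> Q A", OF definable_not[OF assms]]) blast
  have "is_subset Y P" "is_diff Z P Y"
    unfolding is_subset_def is_diff_def using Y(1) Z(1) by blast+
  then have "Y \<epsilon> U \<or> Z \<epsilon> U"
    by (rule U_diff)
  then show ?thesis
    using Y(2) Z(2) by blast
qed

lemma ae_fine:
  assumes "x \<epsilon> X"
  shows "ae (\<lambda>A. x \<epsilon> A)"
proof -
  have "definable (\<lambda>e. x \<epsilon> e 0)"
    by (intro definable_intros)
  then obtain Y where Y: "\<And>A. A \<epsilon> Y \<longleftrightarrow> A \<epsilon> P \<and> x \<epsilon> A" "Y \<epsilon> U \<longleftrightarrow> ae (\<lambda>A. x \<epsilon> A)"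
    by (rule ae_set[of "\<lambda>A. x \<epsilon> A"]) blast
  then show ?thesis
    using fineness assms unfolding is_fine_def by blast
qed

text \<open>Normality as a pressing-down principle: choose a witness inside each \<open>A\<close>,
  then make the choice constant on a set in \<open>U\<close>.\<close>

lemma ae_press:
  assumes Q: "\<And>i j. definable (\<lambda>e. Q (e i) (e j))" and "ae (\<lambda>A. \<exists>y. y \<epsilon> A \<and> Q A y)"
  obtains y where "ae (\<lambda>A. Q A y)"
proof -
  obtain Y where Y: "Y \<epsilon> U" "\<And>A. A \<epsilon> Y \<Longrightarrow> \<exists>y. y \<epsilon> A \<and> Q A y"
    using assms unfolding ae_def by blast
  have "definable (\<lambda>e. e j \<epsilon> e i \<and> Q (e i) (e j))" for i j
    by (intro definable_intros Q)
  moreover have "\<exists>y. y \<epsilon> X \<and> y \<epsilon> A \<and> Q A y" if "A \<epsilon> Y" for A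
    using Y that U_subset Pkappa unfolding is_Pkappa_def is_subset_def by blast
  ultimately obtain f where f: "function_on f Y"
    "\<And>A y. rel f A y \<Longrightarrow> A \<epsilon> Y \<and> y \<epsilon> X \<and> y \<epsilon> A \<and> Q A y"
    by (rule choice_function[of "\<lambda>A y. y \<epsilon> A \<and> Q A y" Y X]) blast+
  then obtain B y where "B \<epsilon> U" "\<And>A. A \<epsilon> B \<Longrightarrow> rel f A y"
    using normality Y unfolding is_normal_def by blast
  then show ?thesis
    using that f(2) unfolding ae_def by blast
qed

section \<open>Index sets along which the measure is complete\<close>

text \<open>Equivalently, \<open>U\<close> is closed under intersections of families indexed by \<open>S\<close>.\<close>

definition small :: "'v \<Rightarrow> bool" where
  "small S \<longleftrightarrow> (\<forall>B R. B \<epsilon> U \<longrightarrow> (\<forall>A. A \<epsilon> B \<longrightarrow> (\<exists>s. s \<epsilon> S \<and> rel R A s)) \<longrightarrow>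
     (\<exists>s. s \<epsilon> S \<and> ae (\<lambda>A. rel R A s)))"

text \<open>\<open>small\<close> quantifies over relations that are sets, which keeps it
  first-order, so that minimal counterexamples to it can be taken. A definable \<open>Q\<close> is
  brought into this form by restricting it to a set in \<open>U\<close>.\<close>

lemma small_ae:
  assumes "small S" and Q: "\<And>i j. definable (\<lambda>e. Q (e i) (e j))" and "ae (\<lambda>A. \<exists>s. s \<epsilon> S \<and> Q A s)"
  obtains s where "s \<epsilon> S" "ae (\<lambda>A. Q A s)"
proof -
  obtain Y where Y: "Y \<epsilon> U" "\<And>A. A \<epsilon> Y \<Longrightarrow> \<exists>s. s \<epsilon> S \<and> Q A s"
    using assms unfolding ae_def by blast
  obtain r where r: "\<And>A s. rel r A s \<longleftrightarrow> A \<epsilon> Y \<and> s \<epsilon> S \<and> Q A s"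
    by (rule relation_exists[of Q Y S, OF Q]) blast
  then have "\<forall>A. A \<epsilon> Y \<longrightarrow> (\<exists>s. s \<epsilon> S \<and> rel r A s)"
    using Y by blast
  then obtain s where s: "s \<epsilon> S" "ae (\<lambda>A. rel r A s)"
    using \<open>small S\<close> Y(1) unfolding small_def by meson
  from s(2) have "ae (\<lambda>A. Q A s)"
    by (rule ae_mono) (simp add: r)
  with s(1) show ?thesis
    by (rule that)
qed

lemma small_subset:
  assumes "small T" "is_subset S T"
  shows "small S"
  unfolding small_def
proof (intro allI impI)
  fix B R assume B: "B \<epsilon> U" "\<forall>A. A \<epsilon> B \<longrightarrow> (\<exists>s. s \<epsilon> S \<and> rel R A s)"
  have "definable (\<lambda>e. e j \<epsilon> S \<and> rel R (e i) (e j))" for i j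
    unfolding basic_defs by (intro definable_intros)
  moreover have "ae (\<lambda>A. \<exists>s. s \<epsilon> T \<and> s \<epsilon> S \<and> rel R A s)"
    using B assms(2) unfolding ae_def is_subset_def by blast
  ultimately obtain s where s: "ae (\<lambda>A. s \<epsilon> S \<and> rel R A s)"
    by (rule small_ae[of T "\<lambda>A s. s \<epsilon> S \<and> rel R A s", OF \<open>small T\<close>]) blast+
  then have "ae (\<lambda>A. rel R A s)"
    by (rule ae_mono) simp
  then show "\<exists>s. s \<epsilon> S \<and> ae (\<lambda>A. rel R A s)"
    using ae_ex[OF s] by blast
qed

text \<open>Completeness concerns sets of fewer than \<open>\<kappa>\<close> elements of \<open>U\<close>, not indexed families. The
  fibres over \<open>s \<epsilon> b\<close> become pairwise distinct when \<open>s\<close>, as an element of \<open>P\<close>, is put into the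
  fibre over \<open>s\<close>; this does not matter as \<open>U\<close> is not principal.\<close>

lemma small_below:
  assumes b: "b \<epsilon> \<kappa>"
  shows "small b"
  unfolding small_def
proof (intro allI impI)
  fix B R assume B: "B \<epsilon> U" "\<forall>A. A \<epsilon> B \<longrightarrow> (\<exists>s. s \<epsilon> b \<and> rel R A s)"
  show "\<exists>s. s \<epsilon> b \<and> ae (\<lambda>A. rel R A s)"
  proof (rule ccontr)
    assume neg: "\<not> ?thesis"
    define fibre where "fibre s A \<longleftrightarrow> A \<epsilon> b \<and> A = s \<or> \<not> A \<epsilon> b \<and> rel R A s" for s A
    have def_fibre: "definable (\<lambda>e. fibre (e i) (e j))" for i j
      unfolding fibre_def basic_defs by (intro definable_intros)
    have def_fibre': "definable (\<lambda>e. fibre s (e 0))" for s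
      unfolding fibre_def basic_defs by (intro definable_intros)
    have b_\<kappa>: "s \<epsilon> \<kappa>" if "s \<epsilon> b" for s
      using ordinal_mem_transitive[OF ordinal that b] .
    have b_P: "s \<epsilon> P" if "s \<epsilon> b" for s
      using Pkappa subset_X card_less_mem[OF ordinal b_\<kappa>[OF that]]
        ordinal_mem_transitive[OF ordinal _ b_\<kappa>[OF that]]
      unfolding is_Pkappa_def is_subset_def by blast
    have not_fibre: "ae (\<lambda>A. \<not> fibre s A)" if "s \<epsilon> b" for s
    proof -
      have "\<not> ae (fibre s)"
      proof
        assume "ae (fibre s)"
        \<comment> \<open>By fineness \<open>s\<close> belongs to almost every \<open>A\<close>,
          which excludes \<open>A = s\<close>; on the remaining sets the fibre lies inside the one
          given by \<open>R\<close>.\<close>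
        moreover have "ae (\<lambda>A. s \<epsilon> A)"
          using ae_fine subset_X b_\<kappa>[OF that] unfolding is_subset_def by blast
        ultimately have "ae (\<lambda>A. fibre s A \<and> s \<epsilon> A)"
          by (rule ae_conj)
        then have "ae (\<lambda>A. rel R A s)"
          by (rule ae_mono) (use mem_irrefl in \<open>auto simp: fibre_def\<close>)
        then show False
          using neg that by blast
      qed
      then show ?thesis
        using ae_dichotomy[OF def_fibre'] by blast
    qed
    obtain Pw where Pw: "\<And>Y. Y \<epsilon> Pw \<longleftrightarrow> is_subset Y P"
      using power_set by metis
    \<comment> \<open>\<open>Y\<close> is the complement of the fibre over \<open>s\<close>, and all
      these complements belong to \<open>U\<close>. Completeness will be applied to the set
      \<open>F\<close> of them.\<close>
    define Q where "Q s Y \<longleftrightarrow> (\<forall>A. A \<epsilon> Y \<longleftrightarrow> A \<epsilon> P \<and> \<not> fibre s A)" for s Y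
    have def_Q: "definable (\<lambda>e. Q (e i) (e j))" for i j
      unfolding Q_def by (intro definable_intros def_fibre)
    have Q_ex: "\<exists>Y. Q s Y" if "s \<epsilon> b" for s
      by (rule ae_set[OF definable_not[OF def_fibre'[of s]]]) (unfold Q_def, blast)
    have Q_U: "Y \<epsilon> U" if "s \<epsilon> b" "Q s Y" for s Y
    proof -
      obtain Y' where Y': "\<And>A. A \<epsilon> Y' \<longleftrightarrow> A \<epsilon> P \<and> \<not> fibre s A" "Y' \<epsilon> U \<longleftrightarrow> ae (\<lambda>A. \<not> fibre s A)"
        by (rule ae_set[OF definable_not[OF def_fibre'[of s]]]) blast
      then have "Y' = Y"
        using that(2) unfolding Q_def by (blast intro: extensionality)
      then show ?thesis
        using Y' not_fibre that by blast
    qed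
    have "definable (\<lambda>e. \<exists>s. s \<epsilon> b \<and> Q s (e 0))"
      by (intro definable_intros def_Q)
    then obtain F where F: "\<And>Y. Y \<epsilon> F \<longleftrightarrow> Y \<epsilon> U \<and> (\<exists>s. s \<epsilon> b \<and> Q s Y)"
      by (rule separation_definable[where a = U]) blast
    have "equipotent b F"
    proof (rule equipotentI[of Q, OF def_Q])
      show "\<exists>Y. Y \<epsilon> F \<and> Q s Y" if "s \<epsilon> b" for s
        using Q_ex[OF that] Q_U[OF that] F that by blast
      show "\<exists>s. s \<epsilon> b \<and> Q s Y" if "Y \<epsilon> F" for Y
        using F that by blast
      fix s Y s' Y'
      assume *: "s \<epsilon> b" "s' \<epsilon> b" "Q s Y" "Q s' Y'"
      \<comment> \<open>On elements of \<open>b\<close> the fibres reduce to equality, so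
        \<open>s\<close> lies in its own fibre and in no other.\<close>
      have "\<not> s \<epsilon> Y" "s \<epsilon> Y'" if "s \<noteq> s'"
        using * that b_P unfolding Q_def fibre_def by blast+
      then show "s = s' \<longleftrightarrow> Y = Y'"
        using * unfolding Q_def by (blast intro: extensionality)
    qed
    then have card: "card_less F \<kappa>"
      using card_less_mem[OF ordinal b] card_less_equipotent equipotent_sym by blast
    obtain s where s: "s \<epsilon> b"
      using ae_ex[OF ae_U[OF B(1)]] B(2) ae_U[OF B(1)] ae_ex by blast
    then have nonvoid: "\<not> is_void F"
      using Q_ex Q_U F unfolding is_void_def by blast
    have "definable (\<lambda>e. \<forall>Y. Y \<epsilon> F \<longrightarrow> e 0 \<epsilon> Y)"
      by (intro definable_intros)
    then obtain I where I: "\<And>A. A \<epsilon> I \<longleftrightarrow> A \<epsilon> P \<and> (\<forall>Y. Y \<epsilon> F \<longrightarrow> A \<epsilon> Y)"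
      by (rule separation_definable[where a = P]) blast
    then have "is_Inter I F"
      using nonvoid U_subset F unfolding is_Inter_def is_void_def by blast
    moreover have "is_subset F U"
      using F unfolding is_subset_def by blast
    ultimately have "I \<epsilon> U"
      using completeness nonvoid card unfolding is_complete_def by blast
    \<comment> \<open>Being in \<open>I\<close>, this \<open>A\<close> avoids every fibre, yet it
      lies in some fibre: the one over \<open>A\<close> itself if it is in \<open>b\<close>,
      otherwise one provided by \<open>R\<close> on \<open>B\<close>.\<close>
    then obtain A where A: "A \<epsilon> I" "A \<epsilon> B"
      using ae_ex[OF ae_conj[OF ae_U ae_U[OF B(1)]]] by blast
    obtain t where t: "t \<epsilon> b" "fibre t A"
    proof (cases "A \<epsilon> b")
      case False
      then show ?thesis
        using B(2) A(2) that unfolding fibre_def by blast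
    qed (use that in \<open>auto simp: fibre_def\<close>)
    then show False
      using Q_ex[OF t(1)] Q_U[OF t(1)] F I A(1) unfolding Q_def by blast
  qed
qed

text \<open>Let \<open>f\<close> pick a subset of \<open>S\<close> for each \<open>A\<close>.
  Membership of each \<open>v\<close> in the picked subset is decided almost everywhere, and
  \<open>s\<^sub>0\<close> collects the positive decisions. If the pick differed from
  \<open>s\<^sub>0\<close> almost everywhere, smallness of \<open>S\<close> would fix a single
  \<open>v\<close> of disagreement, against the decision at \<open>v\<close>.\<close>

lemma small_Pow:
  assumes "small S" and T: "\<And>s. s \<epsilon> T \<longleftrightarrow> is_subset s S"
  shows "small T"
  unfolding small_def
proof (intro allI impI)
  fix B R assume B: "B \<epsilon> U" "\<forall>A. A \<epsilon> B \<longrightarrow> (\<exists>s. s \<epsilon> T \<and> rel R A s)"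
  have "definable (\<lambda>e. rel R (e i) (e j))" for i j
    unfolding basic_defs by (intro definable_intros)
  then obtain f where f: "function_on f B" "\<And>A s. rel f A s \<Longrightarrow> A \<epsilon> B \<and> s \<epsilon> T \<and> rel R A s"
    by (rule choice_function[of "rel R" B T]) (use B(2) in blast)+
  have "definable (\<lambda>e. ae (\<lambda>A. \<exists>s. rel f A s \<and> e 0 \<epsilon> s))"
    unfolding ae_def basic_defs by (intro definable_intros)
  then obtain s\<^sub>0 where s\<^sub>0: "\<And>v. v \<epsilon> s\<^sub>0 \<longleftrightarrow> v \<epsilon> S \<and> ae (\<lambda>A. \<exists>s. rel f A s \<and> v \<epsilon> s)"
    by (rule separation_definable[where a = S]) blast
  have "ae (\<lambda>A. rel f A s\<^sub>0)"
  proof (rule ccontr)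
    assume "\<not> ?thesis"
    moreover have "definable (\<lambda>e. rel f (e 0) s\<^sub>0)"
      unfolding basic_defs by (intro definable_intros)
    ultimately have neg: "ae (\<lambda>A. \<not> rel f A s\<^sub>0)"
      using ae_dichotomy[of "\<lambda>A. rel f A s\<^sub>0"] by blast
moreover     have def: "definable (\<lambda>e. \<not> ((\<exists>s. rel f (e i) s \<and> e j \<epsilon> s) \<longleftrightarrow> e j \<epsilon> s\<^sub>0))" for i j
      unfolding basic_defs by (intro definable_intros)
    from ae_conj[OF neg ae_U[OF B(1)]]
    have "ae (\<lambda>A. \<exists>v. v \<epsilon> S \<and> \<not> ((\<exists>s. rel f A s \<and> v \<epsilon> s) \<longleftrightarrow> v \<epsilon> s\<^sub>0))"
    proof (rule ae_mono)
      fix A assume A: "\<not> rel f A s\<^sub>0 \<and> A \<epsilon> B"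
      then obtain s where s: "rel f A s"
        using f(1) function_onD(1) by blast
      then have "s \<noteq> s\<^sub>0"
        using A by blast
      then obtain v where v: "\<not> (v \<epsilon> s \<longleftrightarrow> v \<epsilon> s\<^sub>0)"
        using extensionality by blast
      moreover have "v \<epsilon> S"
        using v s f(2) T s\<^sub>0 unfolding is_subset_def by blast
      ultimately show "\<exists>v. v \<epsilon> S \<and> \<not> ((\<exists>s. rel f A s \<and> v \<epsilon> s) \<longleftrightarrow> v \<epsilon> s\<^sub>0)"
        using s f(1) function_onD(3) by metis
    qed
    then obtain v where "v \<epsilon> S" and v: "ae (\<lambda>A. \<not> ((\<exists>s. rel f A s \<and> v \<epsilon> s) \<longleftrightarrow> v \<epsilon> s\<^sub>0))"
      by (rule small_ae[of S "\<lambda>A v. \<not> ((\<exists>s. rel f A s \<and> v \<epsilon> s) \<longleftrightarrow> v \<epsilon> s\<^sub>0)", OF \<open>small S\<close> def]) blast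
    show False
    proof (cases "v \<epsilon> s\<^sub>0")
      case True
      then have "ae (\<lambda>A. \<exists>s. rel f A s \<and> v \<epsilon> s)"
        using s\<^sub>0 by blast
      then show False
        using ae_ex[OF ae_conj[OF v]] True by blast
    next
      case False
      then have "ae (\<lambda>A. \<exists>s. rel f A s \<and> v \<epsilon> s)"
        using ae_mono[OF v] by simp
      then show False
        using s\<^sub>0 False \<open>v \<epsilon> S\<close> by blast
    qed
  qed
  have "s\<^sub>0 \<epsilon> T"
    unfolding T is_subset_def using s\<^sub>0 by blast
  moreover have "ae (\<lambda>A. rel R A s\<^sub>0)"
    using \<open>ae (\<lambda>A. rel f A s\<^sub>0)\<close> by (rule ae_mono) (use f(2) in blast)
  ultimately show "\<exists>s. s \<epsilon> T \<and> ae (\<lambda>A. rel R A s)"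
    by blast
qed

section \<open>Representing \<kappa> in the ultrapower\<close>

lemma ae_below_subset:
  assumes "a \<epsilon> \<kappa>"
  shows "ae (\<lambda>A. \<forall>x. x \<epsilon> a \<longrightarrow> x \<epsilon> A)"
proof (rule ccontr)
  assume neg: "\<not> ?thesis"
  have "definable (\<lambda>e. \<forall>x. x \<epsilon> a \<longrightarrow> x \<epsilon> e 0)"
    by (intro definable_intros)
  with neg have missed: "ae (\<lambda>A. \<exists>x. x \<epsilon> a \<and> \<not> x \<epsilon> A)"
    using ae_dichotomy[of "\<lambda>A. \<forall>x. x \<epsilon> a \<longrightarrow> x \<epsilon> A"] by auto
  have def: "definable (\<lambda>e. \<not> e j \<epsilon> e i)" for i j
    by (intro definable_intros)
  from missed obtain x where "x \<epsilon> a" "ae (\<lambda>A. \<not> x \<epsilon> A)"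
    by (rule small_ae[of a "\<lambda>A x. \<not> x \<epsilon> A", OF small_below[OF assms] def]) blast
  then show False
    using ae_ex[OF ae_conj[OF _ ae_fine]] subset_X ordinal_mem_transitive[OF ordinal _ assms]
    unfolding is_subset_def by blast
qed

text \<open>In the ultrapower by \<open>U\<close>, such a function represents \<open>\<kappa>\<close>.\<close>

definition critical :: "'v \<Rightarrow> bool" where
  "critical f \<longleftrightarrow> function_on f P \<and> (\<forall>A b. rel f A b \<longrightarrow> b \<epsilon> \<kappa> \<and> (\<forall>a. a \<epsilon> b \<longrightarrow> a \<epsilon> A)) \<and>
     (\<forall>a. a \<epsilon> \<kappa> \<longrightarrow> ae (\<lambda>A. \<exists>b. rel f A b \<and> a \<epsilon> b))"

lemma criticalD:
  assumes "critical f"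
  shows "function_on f P" "rel f A b \<Longrightarrow> b \<epsilon> \<kappa>" "rel f A b \<Longrightarrow> a \<epsilon> b \<Longrightarrow> a \<epsilon> A"
    "a \<epsilon> \<kappa> \<Longrightarrow> ae (\<lambda>A. \<exists>b. rel f A b \<and> a \<epsilon> b)"
  using assms unfolding critical_def by blast+

lemma critical_exists: "\<exists>f. critical f"
proof -
  \<comment> \<open>For \<open>b\<close> in \<kappa> this says that \<open>b\<close> is the least
    element of \<kappa> outside \<open>A\<close>. There is one because \<open>A\<close> has fewer
    than \<kappa> elements and so cannot include \<kappa>.\<close>
  define Q where "Q A b \<longleftrightarrow> \<not> b \<epsilon> A \<and> (\<forall>a. a \<epsilon> b \<longrightarrow> a \<epsilon> A)" for A b
  have Q_ex: "\<exists>b. b \<epsilon> \<kappa> \<and> Q A b" if "A \<epsilon> P" for A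
  proof -
    have "card_less A \<kappa>"
      using that Pkappa unfolding is_Pkappa_def by blast
    then obtain x where x: "x \<epsilon> \<kappa>" "\<not> x \<epsilon> A"
      using not_card_less_superset[OF cardinal] unfolding is_subset_def by blast
    have "definable (\<lambda>e. \<not> e 0 \<epsilon> A)"
      by (intro definable_intros)
    then obtain m where "m \<epsilon> \<kappa>" "\<not> m \<epsilon> A" "\<And>z. z \<epsilon> m \<Longrightarrow> z \<epsilon> \<kappa> \<Longrightarrow> \<not> \<not> z \<epsilon> A"
      by (rule minimal_element[of "\<lambda>x. \<not> x \<epsilon> A" x \<kappa>, OF _ x]) blast
    then show ?thesis
      unfolding Q_def using ordinal_mem_transitive[OF ordinal] by blast
  qed
  have def: "definable (\<lambda>e. Q (e i) (e j))" for i j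
    unfolding Q_def by (intro definable_intros)
  obtain f where f: "function_on f P" "\<And>A b. rel f A b \<Longrightarrow> A \<epsilon> P \<and> b \<epsilon> \<kappa> \<and> Q A b"
    by (rule choice_function[of Q P \<kappa>, OF def Q_ex]) blast+
  have "ae (\<lambda>A. \<exists>b. rel f A b \<and> a \<epsilon> b)" if a: "a \<epsilon> \<kappa>" for a
  proof -
    have "ae (\<lambda>A. a \<epsilon> A)"
      using ae_fine subset_X a unfolding is_subset_def by blast
    from ae_conj[OF this ae_below_subset[OF a]] show ?thesis
    proof (rule ae_mono)
      fix A assume A: "A \<epsilon> P" "a \<epsilon> A \<and> (\<forall>x. x \<epsilon> a \<longrightarrow> x \<epsilon> A)"
      then obtain b where b: "rel f A b"
        using function_onD(1)[OF f(1)] by blast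
      \<comment> \<open>Both \<open>a\<close> and all its elements are in \<open>A\<close>, while
        \<open>b\<close> is not; linearity leaves only \<open>a\<close> below
        \<open>b\<close>.\<close>
      then have "a \<epsilon> b"
        using A f(2)[OF b] ordinal_linear[OF ordinal a, of b] unfolding Q_def by blast
      with b show "\<exists>b. rel f A b \<and> a \<epsilon> b"
        by blast
    qed
  qed
  then show ?thesis
    unfolding critical_def using f Q_def by meson
qed

text \<open>A critical function has values in \<kappa> and almost everywhere exceeds
  \<open>a\<close>, so \<kappa> is a limit ordinal.\<close>

lemma unbounded:
  assumes "a \<epsilon> \<kappa>"
  shows "\<exists>b. b \<epsilon> \<kappa> \<and> a \<epsilon> b"
proof -
  obtain f where f: "critical f"
    using critical_exists by blast
  show ?thesis
    using ae_ex[OF criticalD(4)[OF f assms]] criticalD(2)[OF f] by blast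
qed

section \<open>Levels of the cumulative hierarchy below \<kappa>\<close>

text \<open>Smallness takes the place of the cardinality bound that inaccessibility gives. At a
  least failure \<open>m\<close>, a choice from level \<open>m\<close> first determines, almost
  everywhere, one \<open>c\<close> below \<open>m\<close> by \<open>small_below\<close>, and then
  one subset of level \<open>c\<close> by \<open>small_Pow\<close>.\<close>

lemma small_levels:
  assumes step: "\<And>b Vb x. rel f b Vb \<Longrightarrow>
      x \<epsilon> Vb \<longleftrightarrow> (\<exists>c Vc. c \<epsilon> b \<and> rel f c Vc \<and> is_subset x Vc)"
    and functional: "\<And>b V V'. rel f b V \<Longrightarrow> rel f b V' \<Longrightarrow> V = V'"
    and "b \<epsilon> \<kappa>" "rel f b Vb"
  shows "small Vb"
proof (rule ccontr)
  define Q where "Q b \<longleftrightarrow> (\<exists>Vb. rel f b Vb \<and> \<not> small Vb)" for b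
  assume "\<not> small Vb"
  then have "Q b"
    unfolding Q_def using assms by blast
  have "definable (\<lambda>e. Q (e 0))"
    unfolding Q_def small_def ae_def basic_defs by (intro definable_intros)
  then obtain m where m: "m \<epsilon> \<kappa>" "Q m" and min: "\<And>z. z \<epsilon> m \<Longrightarrow> z \<epsilon> \<kappa> \<Longrightarrow> \<not> Q z"
    by (rule minimal_element[of Q b \<kappa>, OF _ \<open>b \<epsilon> \<kappa>\<close> \<open>Q b\<close>]) blast
  obtain Vm where Vm: "rel f m Vm" "\<not> small Vm"
    using m unfolding Q_def by blast
  have "small Vm"
    unfolding small_def
  proof (intro allI impI)
    fix B R assume B: "B \<epsilon> U" "\<forall>A. A \<epsilon> B \<longrightarrow> (\<exists>s. s \<epsilon> Vm \<and> rel R A s)"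
    define N where "N A c \<longleftrightarrow> (\<exists>Vc s. rel f c Vc \<and> is_subset s Vc \<and> rel R A s)" for A c
    have lower: "ae (\<lambda>A. \<exists>c. c \<epsilon> m \<and> N A c)"
      using ae_U[OF B(1)] by (rule ae_mono) (use B(2) step[OF Vm(1)] N_def in blast)
    have def: "definable (\<lambda>e. N (e i) (e j))" for i j
      unfolding N_def basic_defs by (intro definable_intros)
    from lower obtain c where c: "c \<epsilon> m" "ae (\<lambda>A. N A c)"
      by (rule small_ae[of m N, OF small_below[OF m(1)] def]) blast
    obtain D where D: "D \<epsilon> U" "\<And>A. A \<epsilon> D \<Longrightarrow> N A c"
      using c(2) unfolding ae_def by blast
    obtain Vc where Vc: "rel f c Vc"
      using ae_ex[OF c(2)] unfolding N_def by blast
    obtain T where T: "\<And>s. s \<epsilon> T \<longleftrightarrow> is_subset s Vc"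
      using power_set by metis
    have "small Vc"
      using min ordinal_mem_transitive[OF ordinal c(1) m(1)] c(1) Vc unfolding Q_def by blast
    then have "small T"
      using T by (rule small_Pow)
    moreover have "\<exists>s. s \<epsilon> T \<and> rel R A s" if "A \<epsilon> D" for A
      using D(2)[OF that] T functional[OF Vc] unfolding N_def by blast
    ultimately obtain s where "s \<epsilon> T" "ae (\<lambda>A. rel R A s)"
      using D(1) unfolding small_def by blast
    then show "\<exists>s. s \<epsilon> Vm \<and> ae (\<lambda>A. rel R A s)"
      using T Vc step[OF Vm(1)] c(1) by blast
  qed
  with Vm show False
    by blast
qed

end

subsection \<open>Graph sequences\<close>

context zfc_model
begin

definition vert :: "'v \<Rightarrow> 'v \<Rightarrow> 'v \<Rightarrow> bool" where
  "vert G a v \<longleftrightarrow> (\<exists>g V E. rel G a g \<and> is_opair g V E \<and> v \<epsilon> V)"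

definition edge :: "'v \<Rightarrow> 'v \<Rightarrow> 'v \<Rightarrow> 'v \<Rightarrow> bool" where
  "edge G a v w \<longleftrightarrow> (\<exists>g V E. rel G a g \<and> is_opair g V E \<and> rel E v w)"

text \<open>\<open>H\<close> is to choose a homomorphism from \<open>G\<^sub>b\<close> to \<open>G\<^sub>a\<close> for each pair \<open>a \<epsilon> b\<close>.\<close>

definition proj :: "'v \<Rightarrow> 'v \<Rightarrow> 'v \<Rightarrow> 'v \<Rightarrow> 'v \<Rightarrow> bool" where
  "proj H a b v w \<longleftrightarrow> (\<exists>p h. is_opair p a b \<and> rel H p h \<and> rel h v w)"

text \<open>The threads are the vertices of the product of all \<open>G\<^sub>a\<close> with \<open>a \<epsilon> k\<close>.\<close>

definition thread :: "'v \<Rightarrow> 'v \<Rightarrow> 'v \<Rightarrow> bool" where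
  "thread k G f \<longleftrightarrow> (\<forall>a. a \<epsilon> k \<longrightarrow>
     (\<exists>w. vert G a w \<and> rel f a w \<and> (\<forall>w'. rel f a w' \<longrightarrow> w' = w)))"

lemmas graph_defs = vert_def edge_def proj_def thread_def

end

text \<open>\<open>vert_small\<close> is what membership of the graphs in
  \<open>V\<^sub>\<kappa>\<close> contributes, and \<open>product_X\<close> makes every element of
  the product of the graphs, as a function on \<kappa>, an element of \<open>X\<close>. The
  projections need not commute, as they only serve as components of a map into a product.\<close>

locale graph_sequence_measure = normal_measure mem \<kappa> X P U
  for mem :: "'v \<Rightarrow> 'v \<Rightarrow> bool"  (infix \<open>\<epsilon>\<close> 50) and \<kappa> X P U +
  fixes G H W
  assumes vert_small: "\<And>a. a \<epsilon> \<kappa> \<Longrightarrow> \<exists>Z. small Z \<and> (\<forall>v. v \<epsilon> Z \<longleftrightarrow> vert G a v)"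
    and vert_W: "\<And>a v. vert G a v \<Longrightarrow> v \<epsilon> W"
    and edge_vert: "\<And>a v w. edge G a v w \<Longrightarrow> vert G a v \<and> vert G a w"
    and product_X: "\<And>r. (\<And>p. p \<epsilon> r \<Longrightarrow> \<exists>x y. x \<epsilon> \<kappa> \<and> y \<epsilon> W \<and> is_opair p x y) \<Longrightarrow> r \<epsilon> X"
    and proj_total: "\<And>a b v. a \<epsilon> b \<Longrightarrow> b \<epsilon> \<kappa> \<Longrightarrow> vert G b v \<Longrightarrow> \<exists>w. vert G a w \<and> proj H a b v w"
    and proj_unique: "\<And>a b v w w'. a \<epsilon> b \<Longrightarrow> b \<epsilon> \<kappa> \<Longrightarrow> proj H a b v w \<Longrightarrow> proj H a b v w' \<Longrightarrow> w = w'"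
    and proj_edge: "\<And>a b v w v' w'. a \<epsilon> b \<Longrightarrow> b \<epsilon> \<kappa> \<Longrightarrow> edge G b v w \<Longrightarrow>
      proj H a b v v' \<Longrightarrow> proj H a b w w' \<Longrightarrow> edge G a v' w'"
begin

section \<open>Vertices, threads and the upward homomorphism\<close>

text \<open>Otherwise choose a bad vertex for almost every \<open>A\<close>. Its projection to each
  fixed \<open>G\<^sub>a\<close> is constant almost everywhere, since the vertex set is small, and
  these limits form a thread \<open>f\<close>. Almost every \<open>A\<close> contains
  \<open>f\<close>, so badness gives a coordinate in \<open>A\<close> where \<open>f\<close> is
  wrong; normality fixes this coordinate, against the choice of the limit.\<close>

lemma ae_thread_extends:
  assumes "critical c"
  shows "ae (\<lambda>A. \<forall>b v. rel c A b \<longrightarrow> vert G b v \<longrightarrow>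
    (\<exists>f. f \<epsilon> A \<and> thread \<kappa> G f \<and> (\<forall>a w. a \<epsilon> b \<longrightarrow> proj H a b v w \<longrightarrow> rel f a w)))"
proof (rule ccontr)
  note c_fun = criticalD(1)[OF assms] and c_\<kappa> = criticalD(2)[OF assms]
    and c_sub = criticalD(3)[OF assms] and c_large = criticalD(4)[OF assms]
  assume neg: "\<not> ?thesis"
  define bad where "bad A v \<longleftrightarrow> (\<exists>b. rel c A b \<and> vert G b v \<and>
    (\<forall>f. f \<epsilon> A \<longrightarrow> thread \<kappa> G f \<longrightarrow> (\<exists>a w. a \<epsilon> b \<and> proj H a b v w \<and> \<not> rel f a w)))" for A v
  have def_bad: "definable (\<lambda>e. bad (e i) (e j))" for i j
    unfolding bad_def graph_defs basic_defs by (intro definable_intros)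
  have "definable (\<lambda>e. \<exists>v. bad (e 0) v)"
    unfolding bad_def graph_defs basic_defs by (intro definable_intros)
  moreover have "\<not> ae (\<lambda>A. \<not> (\<exists>v. bad A v))"
    using neg by (rule contrapos_nn) (erule ae_mono, unfold bad_def, blast)
  ultimately have "ae (\<lambda>A. \<exists>v. bad A v)"
    using ae_dichotomy[of "\<lambda>A. \<exists>v. bad A v"] by blast
  then obtain Y where Y: "Y \<epsilon> U" "\<And>A. A \<epsilon> Y \<Longrightarrow> \<exists>v. bad A v"
    unfolding ae_def by blast
  have "\<exists>v. v \<epsilon> W \<and> bad A v" if "A \<epsilon> Y" for A
    using Y(2)[OF that] vert_W unfolding bad_def by blast
  then obtain k where k: "function_on k Y" "\<And>A v. rel k A v \<Longrightarrow> A \<epsilon> Y \<and> v \<epsilon> W \<and> bad A v"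
    by (rule choice_function[of bad Y W, OF def_bad]) blast+
  \<comment> \<open>The image in \<open>G\<^sub>a\<close> of the bad vertex chosen for
    \<open>A\<close>. It exists only for \<open>a\<close> below the value of \<open>c\<close> at
    \<open>A\<close>, which holds for almost all \<open>A\<close>.\<close>
  define val where
    "val A a w \<longleftrightarrow> (\<exists>b v. rel c A b \<and> rel k A v \<and> a \<epsilon> b \<and> proj H a b v w)" for A a w
  have val_unique: "w = w'" if vals: "val A a w" "val A a w'" for A a w w'
  proof -
    obtain b v where 1: "rel c A b" "rel k A v" "a \<epsilon> b" "proj H a b v w"
      using vals(1) unfolding val_def by blast
    obtain b' v' where 2: "rel c A b'" "rel k A v'" "a \<epsilon> b'" "proj H a b' v' w'"
      using vals(2) unfolding val_def by blast
    have "b = b'" "v = v'"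
      using function_onD(3)[OF c_fun] function_onD(3)[OF k(1)] 1 2 by blast+
    then show ?thesis
      using proj_unique 1 2 c_\<kappa> by blast
  qed
  have val_ex: "\<exists>w. vert G a w \<and> ae (\<lambda>A. val A a w)" if a: "a \<epsilon> \<kappa>" for a
  proof -
    obtain Z where Z: "small Z" "\<And>v. v \<epsilon> Z \<longleftrightarrow> vert G a v"
      using vert_small[OF a] by blast
    have def_val: "definable (\<lambda>e. val (e i) a (e j))" for i j
      unfolding val_def graph_defs basic_defs by (intro definable_intros)
    have "ae (\<lambda>A. \<exists>w. w \<epsilon> Z \<and> val A a w)"
      using ae_conj[OF ae_U[OF Y(1)] c_large[OF a]]
    proof (rule ae_mono)
      fix A assume A: "A \<epsilon> Y \<and> (\<exists>b. rel c A b \<and> a \<epsilon> b)"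
      then obtain b where b: "rel c A b" "a \<epsilon> b"
        by blast
      obtain v where v: "rel k A v"
        using function_onD(1)[OF k(1)] A by blast
      then obtain b' where "rel c A b'" "vert G b' v"
        using k(2) unfolding bad_def by blast
      then have "vert G b v"
        using function_onD(3)[OF c_fun] b by blast
      then obtain w where "vert G a w" "proj H a b v w"
        using proj_total b c_\<kappa> by blast
      then show "\<exists>w. w \<epsilon> Z \<and> val A a w"
        unfolding Z(2) val_def using b v by blast
    qed
    then obtain w where "w \<epsilon> Z" "ae (\<lambda>A. val A a w)"
      by (rule small_ae[of Z "\<lambda>A w. val A a w", OF Z(1) def_val]) blast
    then show ?thesis
      using Z(2) by blast
  qed
  have "definable (\<lambda>e. ae (\<lambda>A. val A (e i) (e j)))" for i j
    unfolding ae_def val_def graph_defs basic_defs by (intro definable_intros)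
  then obtain f where f: "\<And>a w. rel f a w \<longleftrightarrow> a \<epsilon> \<kappa> \<and> w \<epsilon> W \<and> ae (\<lambda>A. val A a w)"
    and fp: "\<And>p. p \<epsilon> f \<Longrightarrow> \<exists>x y. x \<epsilon> \<kappa> \<and> y \<epsilon> W \<and> is_opair p x y"
    by (rule relation_exists[of "\<lambda>a w. ae (\<lambda>A. val A a w)" \<kappa> W]) blast
  have unique: "w = w'" if "ae (\<lambda>A. val A a w)" "ae (\<lambda>A. val A a w')" for a w w'
    using ae_ex[OF ae_conj[OF that]] val_unique by blast
  have thread: "thread \<kappa> G f"
    unfolding thread_def
  proof (intro allI impI)
    fix a assume a: "a \<epsilon> \<kappa>"
    then obtain w where "vert G a w" "ae (\<lambda>A. val A a w)"
      using val_ex by blast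
    then show "\<exists>w. vert G a w \<and> rel f a w \<and> (\<forall>w'. rel f a w' \<longrightarrow> w' = w)"
      using f vert_W a unique by blast
  qed
  have "f \<epsilon> X"
    using fp by (rule product_X)
  \<comment> \<open>The wrong coordinate is below the value of \<open>c\<close> at \<open>A\<close>,
    hence an element of \<open>A\<close> by criticality; this is what allows pressing down.\<close>
  have "ae (\<lambda>A. \<exists>a. a \<epsilon> A \<and> (\<exists>w. val A a w \<and> a \<epsilon> \<kappa> \<and> \<not> rel f a w))"
    using ae_conj[OF ae_U[OF Y(1)] ae_fine[OF \<open>f \<epsilon> X\<close>]]
  proof (rule ae_mono)
    fix A assume A: "A \<epsilon> Y \<and> f \<epsilon> A"
    then obtain v where v: "rel k A v"
      using function_onD(1)[OF k(1)] by blast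
    then have "bad A v"
      using k(2) by blast
    then obtain b a w where "rel c A b" "a \<epsilon> b" "proj H a b v w" "\<not> rel f a w"
      using A thread unfolding bad_def by blast
    then show "\<exists>a. a \<epsilon> A \<and> (\<exists>w. val A a w \<and> a \<epsilon> \<kappa> \<and> \<not> rel f a w)"
      using v c_sub c_\<kappa> ordinal_mem_transitive[OF ordinal] unfolding val_def by blast
  qed
  moreover have "definable (\<lambda>e. \<exists>w. val (e i) (e j) w \<and> e j \<epsilon> \<kappa> \<and> \<not> rel f (e j) w)" for i j
    unfolding val_def graph_defs basic_defs by (intro definable_intros)
  ultimately obtain a where a: "ae (\<lambda>A. \<exists>w. val A a w \<and> a \<epsilon> \<kappa> \<and> \<not> rel f a w)"
    using ae_press[of "\<lambda>A a. \<exists>w. val A a w \<and> a \<epsilon> \<kappa> \<and> \<not> rel f a w"] by blast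
  then have "a \<epsilon> \<kappa>"
    using ae_ex by blast
  then obtain w where w: "vert G a w" "ae (\<lambda>A. val A a w)"
    using val_ex by blast
  obtain A where A: "val A a w" "\<exists>w. val A a w \<and> a \<epsilon> \<kappa> \<and> \<not> rel f a w"
    using ae_ex[OF ae_conj[OF w(2) a]] by blast
  then have "\<not> rel f a w"
    using val_unique by blast
  then show False
    using f w vert_W \<open>a \<epsilon> \<kappa>\<close> by blast
qed

text \<open>In a counterexample normality, applied twice, fixes \<open>f\<close> and
  \<open>g\<close>. They then fail to be adjacent at some fixed \<open>a\<close>, but almost
  everywhere \<open>a\<close> lies below the value of \<open>c\<close>, where adjacency was
  assumed.\<close>

lemma ae_adjacent_extends:
  assumes "critical c"
  shows "ae (\<lambda>A. \<forall>b f g. rel c A b \<longrightarrow> f \<epsilon> A \<longrightarrow> g \<epsilon> A \<longrightarrow>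
    (\<forall>a. a \<epsilon> b \<longrightarrow> (\<exists>x y. rel f a x \<and> rel g a y \<and> edge G a x y)) \<longrightarrow>
    (\<forall>a. a \<epsilon> \<kappa> \<longrightarrow> (\<exists>x y. rel f a x \<and> rel g a y \<and> edge G a x y)))"
proof (rule ccontr)
  note c_fun = criticalD(1)[OF assms] and c_large = criticalD(4)[OF assms]
  assume neg: "\<not> ?thesis"
  define adj where "adj f g a \<longleftrightarrow> (\<exists>x y. rel f a x \<and> rel g a y \<and> edge G a x y)" for f g a
  define bad where "bad A f g \<longleftrightarrow>
    (\<exists>b. rel c A b \<and> (\<forall>a. a \<epsilon> b \<longrightarrow> adj f g a) \<and> \<not> (\<forall>a. a \<epsilon> \<kappa> \<longrightarrow> adj f g a))" for A f g
  have "definable (\<lambda>e. \<exists>f. f \<epsilon> e 0 \<and> (\<exists>g. g \<epsilon> e 0 \<and> bad (e 0) f g))"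
    unfolding bad_def adj_def graph_defs basic_defs by (intro definable_intros)
  moreover have "\<not> ae (\<lambda>A. \<not> (\<exists>f. f \<epsilon> A \<and> (\<exists>g. g \<epsilon> A \<and> bad A f g)))"
    using neg by (rule contrapos_nn) (erule ae_mono, unfold bad_def adj_def, blast)
  ultimately have "ae (\<lambda>A. \<exists>f. f \<epsilon> A \<and> (\<exists>g. g \<epsilon> A \<and> bad A f g))"
    using ae_dichotomy[of "\<lambda>A. \<exists>f. f \<epsilon> A \<and> (\<exists>g. g \<epsilon> A \<and> bad A f g)"] by blast
  moreover have "definable (\<lambda>e. \<exists>g. g \<epsilon> e i \<and> bad (e i) (e j) g)" for i j
    unfolding bad_def adj_def graph_defs basic_defs by (intro definable_intros)
  ultimately obtain f where "ae (\<lambda>A. \<exists>g. g \<epsilon> A \<and> bad A f g)"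
    using ae_press[of "\<lambda>A f. \<exists>g. g \<epsilon> A \<and> bad A f g"] by blast
  moreover have "definable (\<lambda>e. bad (e i) f (e j))" for i j
    unfolding bad_def adj_def graph_defs basic_defs by (intro definable_intros)
  ultimately obtain g where bad: "ae (\<lambda>A. bad A f g)"
    using ae_press[of "\<lambda>A g. bad A f g"] by blast
  obtain a where a: "a \<epsilon> \<kappa>" "\<not> adj f g a"
    using ae_ex[OF bad] unfolding bad_def by blast
  obtain A where "bad A f g" "\<exists>b. rel c A b \<and> a \<epsilon> b"
    using ae_ex[OF ae_conj[OF bad c_large[OF a(1)]]] by blast
  then show False
    using function_onD(3)[OF c_fun] a(2) unfolding bad_def by blast
qed

text \<open>One \<open>A\<close> satisfying both preceding statements suffices. With
  \<open>b\<close> the value of \<open>c\<close> at \<open>A\<close>, a vertex of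
  \<open>G\<^sub>b\<close> is sent to a thread in \<open>A\<close> extending its projections, and
  the thread is evaluated at some \<open>b'\<close> above \<open>b\<close>.\<close>

lemma homomorphism_upward:
  obtains b b' h where "b \<epsilon> b'" "b' \<epsilon> \<kappa>"
    and "\<And>p. p \<epsilon> h \<Longrightarrow> \<exists>v w. is_opair p v w"
    and "\<And>v. (\<exists>w. rel h v w) \<longleftrightarrow> vert G b v" "\<And>v w. rel h v w \<Longrightarrow> vert G b' w"
    and "\<And>v w w'. rel h v w \<Longrightarrow> rel h v w' \<Longrightarrow> w = w'"
    and "\<And>v w v' w'. edge G b v w \<Longrightarrow> rel h v v' \<Longrightarrow> rel h w w' \<Longrightarrow> edge G b' v' w'"
proof -
  obtain c where c: "critical c"
    using critical_exists by blast
  note c_fun = criticalD(1)[OF c] and c_\<kappa> = criticalD(2)[OF c]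
  obtain A where A: "A \<epsilon> P" and A_ext: "\<forall>b v. rel c A b \<longrightarrow> vert G b v \<longrightarrow>
      (\<exists>f. f \<epsilon> A \<and> thread \<kappa> G f \<and> (\<forall>a w. a \<epsilon> b \<longrightarrow> proj H a b v w \<longrightarrow> rel f a w))"
    and A_adj: "\<forall>b f g. rel c A b \<longrightarrow> f \<epsilon> A \<longrightarrow> g \<epsilon> A \<longrightarrow>
      (\<forall>a. a \<epsilon> b \<longrightarrow> (\<exists>x y. rel f a x \<and> rel g a y \<and> edge G a x y)) \<longrightarrow>
      (\<forall>a. a \<epsilon> \<kappa> \<longrightarrow> (\<exists>x y. rel f a x \<and> rel g a y \<and> edge G a x y))"
    using ae_ex[OF ae_conj[OF ae_thread_extends[OF c] ae_adjacent_extends[OF c]]] by (elim exE conjE)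
  have ext: "\<And>b v. rel c A b \<Longrightarrow> vert G b v \<Longrightarrow>
      \<exists>f. f \<epsilon> A \<and> thread \<kappa> G f \<and> (\<forall>a w. a \<epsilon> b \<longrightarrow> proj H a b v w \<longrightarrow> rel f a w)"
    using A_ext by simp
  have adj: "\<And>b f g a. rel c A b \<Longrightarrow> f \<epsilon> A \<Longrightarrow> g \<epsilon> A \<Longrightarrow>
      (\<And>a. a \<epsilon> b \<Longrightarrow> \<exists>x y. rel f a x \<and> rel g a y \<and> edge G a x y) \<Longrightarrow> a \<epsilon> \<kappa> \<Longrightarrow>
      \<exists>x y. rel f a x \<and> rel g a y \<and> edge G a x y"
    using A_adj by simp
  obtain b where b: "rel c A b"
    using function_onD(1)[OF c_fun A] by blast
  then obtain b' where b': "b \<epsilon> b'" "b' \<epsilon> \<kappa>"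
    using unbounded c_\<kappa> by blast
  have b\<kappa>: "b \<epsilon> \<kappa>"
    using c_\<kappa> b .
  obtain Z where Z: "\<And>v. v \<epsilon> Z \<longleftrightarrow> vert G b v"
    using vert_small[OF b\<kappa>] by blast
  define Q where
    "Q v f \<longleftrightarrow> thread \<kappa> G f \<and> (\<forall>a w. a \<epsilon> b \<longrightarrow> proj H a b v w \<longrightarrow> rel f a w)" for v f
  have def_Q: "definable (\<lambda>e. Q (e i) (e j))" for i j
    unfolding Q_def graph_defs basic_defs by (intro definable_intros)
  have "\<exists>f. f \<epsilon> A \<and> Q v f" if "v \<epsilon> Z" for v
    using ext[OF b] that Z unfolding Q_def by blast
  then obtain t where t: "function_on t Z" "\<And>v f. rel t v f \<Longrightarrow> v \<epsilon> Z \<and> f \<epsilon> A \<and> Q v f"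
    by (rule choice_function[of Q Z A, OF def_Q]) blast+
  have "definable (\<lambda>e. \<exists>f. rel t (e i) f \<and> rel f b' (e j))" for i j
    unfolding basic_defs by (intro definable_intros)
  then obtain h where "\<And>v w. rel h v w \<longleftrightarrow> v \<epsilon> Z \<and> w \<epsilon> W \<and> (\<exists>f. rel t v f \<and> rel f b' w)"
    and hp: "\<And>p. p \<epsilon> h \<Longrightarrow> \<exists>x y. x \<epsilon> Z \<and> y \<epsilon> W \<and> is_opair p x y"
    by (rule relation_exists[of "\<lambda>v w. \<exists>f. rel t v f \<and> rel f b' w" Z W]) blast
  moreover have vert_b': "vert G b' w" if "rel t v f" "rel f b' w" for v f w
    using t(2)[OF that(1)] that(2) b'(2) unfolding Q_def thread_def by blast
  ultimately have h: "rel h v w \<longleftrightarrow> (\<exists>f. rel t v f \<and> rel f b' w)" for v w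
    using t(2) vert_W by blast
  show ?thesis
  proof
    show "b \<epsilon> b'" "b' \<epsilon> \<kappa>"
      by (fact b')+
    show "\<exists>v w. is_opair p v w" if "p \<epsilon> h" for p
      using hp that by blast
    show "(\<exists>w. rel h v w) \<longleftrightarrow> vert G b v" for v
    proof
      assume "\<exists>w. rel h v w"
      then show "vert G b v"
        using h t(2) Z by blast
    next
      assume "vert G b v"
      then obtain f where f: "rel t v f"
        using function_onD(1)[OF t(1)] Z by blast
      then have "thread \<kappa> G f"
        using t(2) unfolding Q_def by blast
      then show "\<exists>w. rel h v w"
        using h f b'(2) unfolding thread_def by blast
    qed
    show "vert G b' w" if "rel h v w" for v w
      using that h vert_b' by blast
    show unique: "w = w'" if hw: "rel h v w" "rel h v w'" for v w w'
    proof -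
      obtain f where f: "rel t v f" "rel f b' w" "rel f b' w'"
        using hw h function_onD(3)[OF t(1)] by blast
      then show ?thesis
        using t(2)[OF f(1)] b'(2) unfolding Q_def thread_def by blast
    qed
    show "edge G b' v' w'" if e: "edge G b v w" and hv: "rel h v v'" and hw: "rel h w w'"
      for v w v' w'
    proof -
      obtain f where f: "rel t v f" "rel f b' v'"
        using hv h by blast
      obtain g where g: "rel t w g" "rel g b' w'"
        using hw h by blast
      \<comment> \<open>The projections of an edge are edges at every \<open>a\<close> below
        \<open>b\<close>, so the two threads are adjacent below \<open>b\<close> and therefore also
        at \<open>b'\<close>.\<close>
      have "\<exists>x y. rel f b' x \<and> rel g b' y \<and> edge G b' x y"
      proof (rule adj[OF b _ _ _ b'(2)])
        show "f \<epsilon> A" "g \<epsilon> A"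
          using t(2) f g by blast+
        fix a assume a: "a \<epsilon> b"
        obtain x where x: "proj H a b v x"
          using proj_total[OF a b\<kappa>] edge_vert[OF e] by blast
        obtain y where y: "proj H a b w y"
          using proj_total[OF a b\<kappa>] edge_vert[OF e] by blast
        have "rel f a x" "rel g a y"
          using t(2) f g a x y unfolding Q_def by blast+
        then show "\<exists>x y. rel f a x \<and> rel g a y \<and> edge G a x y"
          using proj_edge[OF a b\<kappa> e x y] by blast
      qed
      then obtain x y where xy: "rel f b' x" "rel g b' y" "edge G b' x y"
        by blast
      then have "rel h v x" "rel h w y"
        using h f g by blast+
      then show ?thesis
        using unique hv hw xy by blast
    qed
  qed
qed

end

section \<open>From supercompactness to the measure argument\<close>

text \<open>Since \<open>V\<close> is an element of an element of \<open>g\<close>, unfolding the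
  hierarchy three times gives a level below \<kappa> that includes \<open>V\<close>.\<close>

lemma (in normal_measure) vlevel_graph_small:
  assumes "is_vlevel \<kappa> S" "g \<epsilon> S" and g: "is_opair g V E"
  shows "small V"
proof -
  obtain f d where f: "function_on f d" "rel f \<kappa> S"
    and step': "\<forall>b Vb. rel f b Vb \<longrightarrow>
      (\<forall>x. x \<epsilon> Vb \<longleftrightarrow> (\<exists>c Vc. c \<epsilon> b \<and> rel f c Vc \<and> is_subset x Vc))"
    using assms(1) unfolding is_vlevel_def by auto
  have step: "x \<epsilon> Vb \<longleftrightarrow> (\<exists>c Vc. c \<epsilon> b \<and> rel f c Vc \<and> is_subset x Vc)" if "rel f b Vb" for b Vb x
    using step' that by blast
  obtain p where p: "p \<epsilon> g" "V \<epsilon> p"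
    using is_opairE[OF g] by blast
  obtain c Vc where c: "c \<epsilon> \<kappa>" "rel f c Vc" "is_subset g Vc"
    using step[OF f(2)] assms(2) by blast
  then have "p \<epsilon> Vc"
    using p(1) unfolding is_subset_def by blast
  then obtain c' Vc' where c': "c' \<epsilon> c" "rel f c' Vc'" "is_subset p Vc'"
    using step[OF c(2)] by blast
  then have "V \<epsilon> Vc'"
    using p(2) unfolding is_subset_def by blast
  then obtain c'' Vc'' where c'': "c'' \<epsilon> c'" "rel f c'' Vc''" "is_subset V Vc''"
    using step[OF c'(2)] by blast
  have "c'' \<epsilon> \<kappa>"
    using ordinal_mem_transitive[OF ordinal] c(1) c'(1) c''(1) by blast
  then have "small Vc''"
    using small_levels[of f c'' Vc'', OF step] function_onD(3)[OF f(1)] c''(2) by blast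
  then show ?thesis
    using c''(3) by (rule small_subset)
qed

context zfc_model
begin

lemma supercompact_hom_upward:
  assumes sc: "is_supercompact \<kappa>" and G: "is_graph_sequence \<kappa> G"
    and down: "\<And>a b ga gb. a \<epsilon> b \<Longrightarrow> b \<epsilon> \<kappa> \<Longrightarrow> rel G a ga \<Longrightarrow> rel G b gb \<Longrightarrow> hom_exists gb ga"
  shows "\<exists>a b ga gb. a \<epsilon> b \<and> b \<epsilon> \<kappa> \<and> rel G a ga \<and> rel G b gb \<and> hom_exists ga gb"
proof -
  obtain S where S: "is_vlevel \<kappa> S" "maps G \<kappa> S" and graph: "\<And>a g. rel G a g \<Longrightarrow> is_graph g"
    using G unfolding is_graph_sequence_def by blast
  have G_fun: "function_on G \<kappa>" and G_S: "\<And>a g. rel G a g \<Longrightarrow> g \<epsilon> S"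
    using S(2) unfolding maps_def by blast+
  have card: "is_cardinal \<kappa>"
    using sc unfolding is_supercompact_def is_uncountable_cardinal_def by blast
  then have ord: "is_ordinal \<kappa>"
    unfolding is_cardinal_def by blast
  have vert: "vert G a v \<longleftrightarrow> v \<epsilon> V" and edge: "edge G a v w \<longleftrightarrow> rel E v w"
    if "rel G a g" "is_opair g V E" for a g V E v w
    unfolding vert_def edge_def using that function_onD(3)[OF G_fun that(1)] is_opair_inject by metis+
  have graphE: "\<exists>g V E. rel G a g \<and> is_opair g V E" if "a \<epsilon> \<kappa>" for a
    using function_onD(1)[OF G_fun that] graph unfolding is_graph_def by blast
  have edge_vert: "vert G a v \<and> vert G a w" if e: "edge G a v w" for a v w
  proof -
    obtain g V E where g: "rel G a g" "is_opair g V E" "rel E v w"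
      using e unfolding edge_def by blast
    obtain V' E' where g': "is_opair g V' E'"
      "\<forall>p. p \<epsilon> E' \<longrightarrow> (\<exists>v w. v \<epsilon> V' \<and> w \<epsilon> V' \<and> is_opair p v w)"
      using graph[OF g(1)] unfolding is_graph_def by blast
    have "V' = V" "E' = E"
      using is_opair_inject[OF g'(1) g(2)] by blast+
    then have "v \<epsilon> V \<and> w \<epsilon> V"
      using g(3) g'(2) is_opair_inject unfolding rel_def by metis
    then show ?thesis
      using vert[OF g(1,2)] by blast
  qed
  \<comment> \<open>A vertex is three membership steps below an element of \<open>S\<close>: it lies
    in \<open>V\<close>, which lies in an element of the pair \<open>g\<close>. Hence the threefold
    union.\<close>
  obtain U\<^sub>1 where U\<^sub>1: "\<And>x. x \<epsilon> U\<^sub>1 \<longleftrightarrow> (\<exists>y. y \<epsilon> S \<and> x \<epsilon> y)"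
    using union by metis
  obtain U\<^sub>2 where U\<^sub>2: "\<And>x. x \<epsilon> U\<^sub>2 \<longleftrightarrow> (\<exists>y. y \<epsilon> U\<^sub>1 \<and> x \<epsilon> y)"
    using union by metis
  obtain W where W: "\<And>x. x \<epsilon> W \<longleftrightarrow> (\<exists>y. y \<epsilon> U\<^sub>2 \<and> x \<epsilon> y)"
    using union by metis
  have vert_W: "v \<epsilon> W" if v: "vert G a v" for a v
  proof -
    obtain g V E where g: "rel G a g" "is_opair g V E" "v \<epsilon> V"
      using v unfolding vert_def by blast
    obtain p where "p \<epsilon> g" "V \<epsilon> p"
      using is_opairE[OF g(2)] by blast
    then show ?thesis
      unfolding W U\<^sub>2 U\<^sub>1 using G_S[OF g(1)] g(3) by blast
  qed
  \<comment> \<open>Supercompactness is applied to the union \<open>X\<close> of \<kappa> and the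
    power set of the product of \<kappa> and \<open>W\<close>.\<close>
  obtain C where C: "\<And>p. p \<epsilon> C \<longleftrightarrow> (\<exists>x y. x \<epsilon> \<kappa> \<and> y \<epsilon> W \<and> is_opair p x y)"
    using product_exists by metis
  obtain PC where PC: "\<And>r. r \<epsilon> PC \<longleftrightarrow> is_subset r C"
    using power_set by metis
  obtain X\<^sub>0 where "is_upair X\<^sub>0 \<kappa> PC"
    using pairing by blast
  moreover obtain X where "\<And>x. x \<epsilon> X \<longleftrightarrow> (\<exists>y. y \<epsilon> X\<^sub>0 \<and> x \<epsilon> y)"
    using union by metis
  ultimately have X: "x \<epsilon> X \<longleftrightarrow> x \<epsilon> \<kappa> \<or> x \<epsilon> PC" for x
    unfolding is_upair_def by auto
  define hom where "hom a b h \<longleftrightarrow>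
    (\<forall>v. vert G b v \<longrightarrow> (\<exists>w. vert G a w \<and> rel h v w)) \<and>
    (\<forall>v w w'. rel h v w \<longrightarrow> rel h v w' \<longrightarrow> w = w') \<and>
    (\<forall>v w v' w'. edge G b v w \<longrightarrow> rel h v v' \<longrightarrow> rel h w w' \<longrightarrow> edge G a v' w')" for a b h
  obtain C' where C': "\<And>p. p \<epsilon> C' \<longleftrightarrow> (\<exists>x y. x \<epsilon> W \<and> y \<epsilon> W \<and> is_opair p x y)"
    using product_exists by metis
  obtain PC' where PC': "\<And>r. r \<epsilon> PC' \<longleftrightarrow> is_subset r C'"
    using power_set by metis
  obtain K where K: "\<And>p. p \<epsilon> K \<longleftrightarrow> (\<exists>a b. a \<epsilon> \<kappa> \<and> b \<epsilon> \<kappa> \<and> is_opair p a b)"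
    using product_exists by metis
  \<comment> \<open>Homomorphisms are chosen for all pairs with \<open>a\<close> below
    \<open>b\<close> at once, as a function on the set \<open>D\<close> of these pairs;
    \<open>PC'\<close>, the relations on \<open>W\<close>, is the set to choose from.\<close>
  have "definable (\<lambda>e. \<exists>a b. is_opair (e 0) a b \<and> a \<epsilon> b)"
    unfolding basic_defs by (intro definable_intros)
  then obtain D where D: "\<And>p. p \<epsilon> D \<longleftrightarrow> p \<epsilon> K \<and> (\<exists>a b. is_opair p a b \<and> a \<epsilon> b)"
    by (rule separation_definable[where a = K]) blast
  have hom_ex: "\<exists>h. h \<epsilon> PC' \<and> hom a b h" if ab: "a \<epsilon> b" "b \<epsilon> \<kappa>" for a b
  proof -
    obtain ga gb where g: "rel G a ga" "rel G b gb"
      using graphE ordinal_mem_transitive[OF ord ab] ab(2) by meson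
    then obtain h V E V' E' where h: "is_opair gb V E" "is_opair ga V' E'" "maps h V V'"
      "\<forall>v w v' w'. rel E v w \<longrightarrow> rel h v v' \<longrightarrow> rel h w w' \<longrightarrow> rel E' v' w'"
      using down[OF ab] unfolding hom_exists_def is_graph_hom_def by meson
    have hf: "function_on h V" and hV': "\<And>v w. rel h v w \<Longrightarrow> w \<epsilon> V'"
      using h(3) unfolding maps_def by blast+
    note vb = vert[OF g(2) h(1)] and eb = edge[OF g(2) h(1)]
      and va = vert[OF g(1) h(2)] and ea = edge[OF g(1) h(2)]
    have "hom a b h"
      unfolding hom_def va vb ea eb using h(4) hV' function_onD[OF hf] by blast
    moreover have "is_subset h C'"
      unfolding is_subset_def
    proof (intro allI impI)
      fix p assume p: "p \<epsilon> h"
      then obtain x y where xy: "is_opair p x y"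
        using hf unfolding function_on_def by blast
      then have "rel h x y"
        unfolding rel_def using p by blast
      then have "x \<epsilon> V" "y \<epsilon> V'"
        using hV' function_onD(2)[OF hf] by blast+
      then have "x \<epsilon> W" "y \<epsilon> W"
        using va vb vert_W by blast+
      then show "p \<epsilon> C'"
        unfolding C' using xy by blast
    qed
    ultimately show ?thesis
      unfolding PC' by blast
  qed
  define Q where "Q p h \<longleftrightarrow> (\<exists>a b. is_opair p a b \<and> hom a b h)" for p h
  have def_Q: "definable (\<lambda>e. Q (e i) (e j))" for i j
    unfolding Q_def hom_def graph_defs basic_defs by (intro definable_intros)
  have "\<exists>h. h \<epsilon> PC' \<and> Q p h" if p: "p \<epsilon> D" for p
  proof -
    obtain a b where ab: "is_opair p a b" "a \<epsilon> b" "p \<epsilon> K"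
      using p unfolding D by blast
    then have "b \<epsilon> \<kappa>"
      unfolding K using is_opair_inject by blast
    then show ?thesis
      using hom_ex[OF ab(2)] ab(1) unfolding Q_def by blast
  qed
  then obtain H where H: "function_on H D" "\<And>p h. rel H p h \<Longrightarrow> p \<epsilon> D \<and> h \<epsilon> PC' \<and> Q p h"
    by (rule choice_function[of Q D PC', OF def_Q]) blast+
  have H_hom: "\<exists>h. hom a b h \<and> (\<forall>v w. proj H a b v w \<longleftrightarrow> rel h v w)" if ab: "a \<epsilon> b" "b \<epsilon> \<kappa>" for a b
  proof -
    obtain p where p: "is_opair p a b"
      using is_opair_exists by blast
    then have "p \<epsilon> D"
      unfolding D K using ab ordinal_mem_transitive[OF ord ab] by blast
    then obtain h where h: "rel H p h"
      using function_onD(1)[OF H(1)] by blast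
    then have "hom a b h"
      using H(2)[OF h] is_opair_inject[OF p] unfolding Q_def by blast
    moreover have "proj H a b v w \<longleftrightarrow> rel h v w" for v w
      unfolding proj_def using p h is_opair_unique[OF p] function_onD(3)[OF H(1) h] by blast
    ultimately show ?thesis
      by blast
  qed
  obtain P U where PU: "is_Pkappa P \<kappa> X" "is_ultrafilter U P" "is_fine U P X" "is_complete \<kappa> U"
    "is_normal U"
    using sc unfolding is_supercompact_def is_supercompact_for_def by blast
  interpret normal_measure "(\<epsilon>)" \<kappa> X P U
    using card PU X by unfold_locales (simp_all add: is_subset_def)
  interpret graph_sequence_measure "(\<epsilon>)" \<kappa> X P U G H W
  proof unfold_locales
    show "\<exists>Z. small Z \<and> (\<forall>v. v \<epsilon> Z \<longleftrightarrow> vert G a v)" if "a \<epsilon> \<kappa>" for a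
      using graphE[OF that] vlevel_graph_small[OF S(1)] G_S vert by meson
    show "vert G a v \<Longrightarrow> v \<epsilon> W" for a v
      by (rule vert_W)
    show "edge G a v w \<Longrightarrow> vert G a v \<and> vert G a w" for a v w
      by (rule edge_vert)
    show "r \<epsilon> X" if "\<And>p. p \<epsilon> r \<Longrightarrow> \<exists>x y. x \<epsilon> \<kappa> \<and> y \<epsilon> W \<and> is_opair p x y" for r
      unfolding X PC is_subset_def C using that by blast
    fix a b assume ab: "a \<epsilon> b" "b \<epsilon> \<kappa>"
    obtain h where h: "hom a b h" "\<And>v w. proj H a b v w \<longleftrightarrow> rel h v w"
      using H_hom[OF ab] by blast
    show "vert G b v \<Longrightarrow> \<exists>w. vert G a w \<and> proj H a b v w" for v
      unfolding h(2) using h(1) unfolding hom_def by blast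
    show "proj H a b v w \<Longrightarrow> proj H a b v w' \<Longrightarrow> w = w'" for v w w'
      unfolding h(2) using h(1) unfolding hom_def by blast
    show "edge G b v w \<Longrightarrow> proj H a b v v' \<Longrightarrow> proj H a b w w' \<Longrightarrow> edge G a v' w'" for v w v' w'
      unfolding h(2) using h(1) unfolding hom_def by blast
  qed
  obtain b b' h where bb': "b \<epsilon> b'" "b' \<epsilon> \<kappa>"
    and hp: "\<And>p. p \<epsilon> h \<Longrightarrow> \<exists>v w. is_opair p v w"
    and hV: "\<And>v. (\<exists>w. rel h v w) \<longleftrightarrow> vert G b v" and hV': "\<And>v w. rel h v w \<Longrightarrow> vert G b' w"
    and hu: "\<And>v w w'. rel h v w \<Longrightarrow> rel h v w' \<Longrightarrow> w = w'"
    and he: "\<And>v w v' w'. edge G b v w \<Longrightarrow> rel h v v' \<Longrightarrow> rel h w w' \<Longrightarrow> edge G b' v' w'"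
    by (rule homomorphism_upward) blast
  obtain g V E where g: "rel G b g" "is_opair g V E"
    using graphE[OF ordinal_mem_transitive[OF ord bb']] by blast
  obtain g' V' E' where g': "rel G b' g'" "is_opair g' V' E'"
    using graphE[OF bb'(2)] by blast
  have "maps h V V'"
    unfolding maps_def function_on_def
    using hp hu hV[unfolded vert[OF g]] hV'[unfolded vert[OF g']] by blast
  then have "is_graph_hom h g g'"
    unfolding is_graph_hom_def using g(2) g'(2) he[unfolded edge[OF g] edge[OF g']] by blast
  then show ?thesis
    unfolding hom_exists_def using bb' g(1) g'(1) by blast
qed

end

theorem proposition1p1:
  fixes mem :: "'v \<Rightarrow> 'v \<Rightarrow> bool" and \<kappa> :: 'v
  assumes "zfc_model mem"
    and "set_lang.is_supercompact mem \<kappa>"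
  shows "\<not> (\<exists>G. set_lang.is_graph_sequence mem \<kappa> G \<and>
    (\<forall>\<alpha> \<alpha>' G\<alpha> G\<alpha>'. (mem \<alpha> \<alpha>' \<or> \<alpha> = \<alpha>') \<longrightarrow> mem \<alpha>' \<kappa> \<longrightarrow>
       set_lang.rel mem G \<alpha> G\<alpha> \<longrightarrow> set_lang.rel mem G \<alpha>' G\<alpha>' \<longrightarrow>
       set_lang.hom_exists mem G\<alpha>' G\<alpha>) \<and>
    (\<forall>\<alpha> \<alpha>' G\<alpha> G\<alpha>'. mem \<alpha> \<alpha>' \<longrightarrow> mem \<alpha>' \<kappa> \<longrightarrow>
       set_lang.rel mem G \<alpha> G\<alpha> \<longrightarrow> set_lang.rel mem G \<alpha>' G\<alpha>' \<longrightarrow>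
       \<not> set_lang.hom_exists mem G\<alpha> G\<alpha>'))"
proof -
  interpret zfc_model mem
    by (fact assms(1))
  show ?thesis
    \<comment> \<open>Property (i) supplies the downward homomorphisms, and the homomorphism
      obtained contradicts (ii).\<close>
    using supercompact_hom_upward[OF assms(2)] by meson
qed

end
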